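(* If $G$ is a finitely generated group with infinitely many ends, then the dimension of $H^2_b(G;\mathbb{R})$ as a real vector space is exactly $2^{\aleph_0}$.
   Context: $H^2_b(G;\mathbb{R})$ denotes the second bounded cohomology of $G$ with real coefficients. The number of ends of a finitely generated group is the number of ends of its Cayley graph with respect to a finite generating set. *)

theory Defs
  imports Complex_Main "HOL-Algebra.Generated_Groups"
begin

definition cayley_adj :: "('a, 'b) monoid_scheme \<Rightarrow> 'a set \<Rightarrow> 'a \<Rightarrow> 'a \<Rightarrow> bool" where
  "cayley_adj G S x y \<longleftrightarrow> x \<in> carrier G \<and> y \<in> carrier G \<and>
     (\<exists>s\<in>S. y = x \<otimes>\<^bsub>G\<^esub> s \<or> x = y \<otimes>\<^bsub>G\<^esub> s)"

definition cayley_component :: "('a, 'b) monoid_scheme \<Rightarrow> 'a set \<Rightarrow> 'a set \<Rightarrow> 'a \<Rightarrow> 'a set" where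
  "cayley_component G S K x =
     {y. (x, y) \<in> ({(u, v). u \<notin> K \<and> v \<notin> K \<and> cayley_adj G S u v})\<^sup>*}"

definition infinite_components :: "('a, 'b) monoid_scheme \<Rightarrow> 'a set \<Rightarrow> 'a set \<Rightarrow> 'a set set" where
  "infinite_components G S K =
     {C. \<exists>x \<in> carrier G - K. C = cayley_component G S K x \<and> infinite C}"

text \<open>The number of ends is the supremum over finite vertex sets K of the number of
  infinite components of the complement of K; it is infinite iff for every n some K
  leaves at least n infinite components.\<close>
definition infinitely_many_ends :: "('a, 'b) monoid_scheme \<Rightarrow> 'a set \<Rightarrow> bool" where
  "infinitely_many_ends G S \<longleftrightarrow>
     (\<forall>n::nat. \<exists>K. finite K \<and> K \<subseteq> carrier G \<and>
        (\<exists>\<C> \<subseteq> infinite_components G S K. finite \<C> \<and> card \<C> = n))"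

definition bounded1 :: "('a, 'b) monoid_scheme \<Rightarrow> ('a \<Rightarrow> real) \<Rightarrow> bool" where
  "bounded1 G f \<longleftrightarrow> (\<exists>M. \<forall>g\<in>carrier G. \<bar>f g\<bar> \<le> M)"

definition bounded2 :: "('a, 'b) monoid_scheme \<Rightarrow> ('a \<Rightarrow> 'a \<Rightarrow> real) \<Rightarrow> bool" where
  "bounded2 G c \<longleftrightarrow> (\<exists>M. \<forall>g\<in>carrier G. \<forall>h\<in>carrier G. \<bar>c g h\<bar> \<le> M)"

definition bounded_2cocycle :: "('a, 'b) monoid_scheme \<Rightarrow> ('a \<Rightarrow> 'a \<Rightarrow> real) \<Rightarrow> bool" where
  "bounded_2cocycle G c \<longleftrightarrow> bounded2 G c \<and>
     (\<forall>g1\<in>carrier G. \<forall>g2\<in>carrier G. \<forall>g3\<in>carrier G.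
        c g2 g3 - c (g1 \<otimes>\<^bsub>G\<^esub> g2) g3 + c g1 (g2 \<otimes>\<^bsub>G\<^esub> g3) - c g1 g2 = 0)"

definition bounded_2coboundary :: "('a, 'b) monoid_scheme \<Rightarrow> ('a \<Rightarrow> 'a \<Rightarrow> real) \<Rightarrow> bool" where
  "bounded_2coboundary G c \<longleftrightarrow> (\<exists>f. bounded1 G f \<and>
     (\<forall>g1\<in>carrier G. \<forall>g2\<in>carrier G. c g1 g2 = f g2 - f (g1 \<otimes>\<^bsub>G\<^esub> g2) + f g1))"

definition lincomb2 :: "('c \<Rightarrow> real) \<Rightarrow> ('c \<Rightarrow> 'a \<Rightarrow> 'a \<Rightarrow> real) \<Rightarrow> 'c set \<Rightarrow> 'a \<Rightarrow> 'a \<Rightarrow> real" where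
  "lincomb2 u b F = (\<lambda>g h. \<Sum>i\<in>F. u i * b i g h)"

text \<open>B is (a set of representatives of) a basis of the real vector space
  H^2_b(G;R) = {bounded 2-cocycles} / {bounded 2-coboundaries}.\<close>
definition H2b_basis :: "('a, 'b) monoid_scheme \<Rightarrow> ('a \<Rightarrow> 'a \<Rightarrow> real) set \<Rightarrow> bool" where
  "H2b_basis G B \<longleftrightarrow>
     (\<forall>c\<in>B. bounded_2cocycle G c) \<and>
     (\<forall>F u. finite F \<longrightarrow> F \<subseteq> B \<longrightarrow> bounded_2coboundary G (lincomb2 u id F) \<longrightarrow>
        (\<forall>c\<in>F. u c = 0)) \<and>
     (\<forall>c. bounded_2cocycle G c \<longrightarrow> (\<exists>F u. finite F \<and> F \<subseteq> B \<and>
        bounded_2coboundary G (\<lambda>g h. c g h - lincomb2 u id F g h)))"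

text \<open>dim H^2_b(G;R) = 2^aleph_0: some basis has the cardinality of the continuum
  (all bases of a vector space are equipotent).\<close>
definition H2b_dim_continuum :: "('a, 'b) monoid_scheme \<Rightarrow> bool" where
  "H2b_dim_continuum G \<longleftrightarrow>
     (\<exists>B. H2b_basis G B \<and> (\<exists>f. bij_betw f B (UNIV :: real set)))"

end

theory Submission
  imports Defs "HOL-Analysis.Abstract_Topology_2" "HOL-Computational_Algebra.Polynomial"
begin

text \<open>
  Stallings' theorem is avoided: Brooks-type counting quasimorphisms are built directly on the
  Cayley graph. Take a finite connected vertex set \<open>K\<close> that separates three translates of itself.
  Disjoint translates of \<open>K\<close> are nested, and ping-pong yields components \<open>P \<noteq> Q\<close> of the complement
  of \<open>K\<close> and a semigroup of elements \<open>x\<close> with \<open>x K \<subseteq> P\<close> and \<open>K \<subseteq> x Q\<close>. For such a \<open>u\<close>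
  count the \<open>g\<close> with \<open>x \<in> g Q\<close> and \<open>y \<in> g u P\<close>, minus those with \<open>x\<close> and \<open>y\<close> exchanged. If finite
  connected sets \<open>g N\<close> and \<open>g' N\<close> both separate three given points, they intersect; so the count has
  bounded defect, although different translates of \<open>K\<close> may cross.

  For pairwise non-commensurable \<open>a, b, c\<close> and large \<open>p\<close>, the quasimorphism of \<open>u = a\<^sup>p b\<^sup>p\<close> grows
  linearly on the powers of \<open>w = a\<^sup>p b\<^sup>p c\<^sup>p\<close>: axes of non-commensurable elements have bounded
  overlap, and reading \<open>w\<close> backwards never shows \<open>a\<^sup>p b\<^sup>p\<close> since the cyclic order of the letters
  is reversed. It vanishes on powers of \<open>a, b, c\<close>, which rules out homomorphisms. Choosing such triples
  inductively gives quasimorphisms \<open>f n\<close> that are triangular with respect to words \<open>w n\<close>; the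
  cocycles of \<open>\<Sum>n. t\<^sup>n f n / D n\<close> for \<open>0 < t < 1\<close> are then independent by a Vandermonde argument. There
  are no more than continuum many functions on a countable group, which bounds the dimension above.
\<close>

section \<open>Connectivity in the Cayley graph\<close>

locale cayley_graph = group G for G (structure) +
  fixes S
  assumes finite_S: "finite S" and S_subset: "S \<subseteq> carrier G" and generate_S: "generate G S = carrier G"
begin

abbreviation adj :: "'a \<Rightarrow> 'a \<Rightarrow> bool" where
  "adj \<equiv> cayley_adj G S"

definition conn :: "'a set \<Rightarrow> 'a \<Rightarrow> 'a \<Rightarrow> bool" where
  "conn T x y \<longleftrightarrow> (x, y) \<in> {(u, v). u \<in> T \<and> v \<in> T \<and> adj u v}\<^sup>*"

definition linked :: "'a set \<Rightarrow> bool" where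
  "linked T \<longleftrightarrow> T \<subseteq> carrier G \<and> (\<forall>x\<in>T. \<forall>y\<in>T. conn T x y)"

text \<open>Components of the complement of \<open>K\<close>, characterised by maximality among
  connected sets. No base vertex is singled out, so they can be translated and compared
  directly.\<close>

definition comp :: "'a set \<Rightarrow> 'a set \<Rightarrow> bool" where
  "comp K C \<longleftrightarrow> linked C \<and> C \<noteq> {} \<and> C \<inter> K = {} \<and>
     (\<forall>T. linked T \<longrightarrow> T \<inter> K = {} \<longrightarrow> T \<inter> C \<noteq> {} \<longrightarrow> T \<subseteq> C)"

lemma adj_sym: "adj x y \<Longrightarrow> adj y x"
  by (auto simp: cayley_adj_def)

lemma adj_translate: "g \<in> carrier G \<Longrightarrow> adj x y \<Longrightarrow> adj (g \<otimes> x) (g \<otimes> y)"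
  unfolding cayley_adj_def using S_subset by (auto simp: m_assoc subset_iff intro: bexI)

lemma conn_refl [simp]: "conn T x x"
  by (simp add: conn_def)

lemma conn_trans: "conn T x y \<Longrightarrow> conn T y z \<Longrightarrow> conn T x z"
  unfolding conn_def by (rule rtrancl_trans)

lemma conn_sym: "conn T x y \<Longrightarrow> conn T y x"
proof -
  have "sym {(u, v). u \<in> T \<and> v \<in> T \<and> adj u v}"
    by (auto simp: sym_def adj_sym)
  then show "conn T x y \<Longrightarrow> conn T y x"
    unfolding conn_def by (meson sym_rtrancl symD)
qed

lemma conn_step: "x \<in> T \<Longrightarrow> y \<in> T \<Longrightarrow> adj x y \<Longrightarrow> conn T x y"
  unfolding conn_def by auto

lemma conn_mono: "conn T x y \<Longrightarrow> T \<subseteq> T' \<Longrightarrow> conn T' x y"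
  unfolding conn_def by (rule rtrancl_mono[THEN subsetD, rotated]) auto

lemma conn_induct [consumes 1, case_names refl step]:
  assumes "conn T x y" "P x"
    and "\<And>y z. conn T x y \<Longrightarrow> y \<in> T \<Longrightarrow> z \<in> T \<Longrightarrow> adj y z \<Longrightarrow> P y \<Longrightarrow> P z"
  shows "P y"
  using assms(1) unfolding conn_def
proof (induction rule: rtrancl_induct)
  case (step y z)
  then show ?case using assms(3)[of y z] by (auto simp: conn_def)
qed (rule assms(2))

lemma conn_finite:
  assumes "conn T x y" "x \<in> T" "T \<subseteq> carrier G"
  shows "\<exists>T'\<subseteq>T. finite T' \<and> linked T' \<and> x \<in> T' \<and> y \<in> T'"
  using assms(1)
proof (induction rule: conn_induct)
  case refl
  then show ?case using assms by (intro exI[of _ "{x}"]) (auto simp: linked_def)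
next
  case (step y z)
  then obtain T' where T': "T' \<subseteq> T" "finite T'" "linked T'" "x \<in> T'" "y \<in> T'" by blast
  have yz: "conn (insert z T') y z"
    using T' step by (intro conn_step) auto
  have a: "conn (insert z T') y v" if "v \<in> insert z T'" for v
  proof (cases "v = z")
    case False
    then have "conn T' y v" using T' that by (auto simp: linked_def)
    then show ?thesis by (rule conn_mono) auto
  qed (use yz in simp)
  have "linked (insert z T')"
    unfolding linked_def
    using T' step assms(3) by (auto intro: conn_trans[OF conn_sym[OF a] a])
  then show ?case using T' step by (intro exI[of _ "insert z T'"]) auto
qed

lemma linkedI:
  assumes "T \<subseteq> carrier G" "\<And>y. y \<in> T \<Longrightarrow> conn T x y"
  shows "linked T"
  unfolding linked_def using assms by (auto intro: conn_trans[OF conn_sym])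

lemma linked_carrierD: "linked T \<Longrightarrow> x \<in> T \<Longrightarrow> x \<in> carrier G"
  by (auto simp: linked_def)

lemma linked_Un:
  assumes "linked A" "linked B" "A \<inter> B \<noteq> {}"
  shows "linked (A \<union> B)"
proof -
  obtain x where x: "x \<in> A" "x \<in> B" using assms by blast
  show ?thesis
  proof (rule linkedI)
    show "A \<union> B \<subseteq> carrier G" using assms by (auto simp: linked_def)
    fix y assume "y \<in> A \<union> B"
    then have "conn A x y \<or> conn B x y" using assms x by (auto simp: linked_def)
    then show "conn (A \<union> B) x y" by (auto intro: conn_mono)
  qed
qed

lemma linked_UN_interval:
  fixes A :: "nat \<Rightarrow> 'a set"
  assumes "\<And>i. m \<le> i \<Longrightarrow> i < n \<Longrightarrow> linked (A i)"
    and "\<And>i. m \<le> i \<Longrightarrow> Suc i < n \<Longrightarrow> A i \<inter> A (Suc i) \<noteq> {}"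
  shows "linked (\<Union>i\<in>{m..<n}. A i)"
  using assms
proof (induction n)
  case 0
  then show ?case by (simp add: linked_def)
next
  case (Suc n)
  have IH: "linked (\<Union>i\<in>{m..<n}. A i)" using Suc by simp
  consider "n < m" | "n = m" | "m < n" by linarith
  then show ?case
  proof cases
    case 1
    then show ?thesis by (simp add: linked_def)
  next
    case 2
    then show ?thesis using Suc.prems(1)[of m] by simp
  next
    case 3
    have "A (n - 1) \<inter> A n \<noteq> {}" using Suc.prems(2)[of "n - 1"] 3 by simp
    moreover have "A (n - 1) \<subseteq> (\<Union>i\<in>{m..<n}. A i)" using 3 by (intro UN_upper) auto
    ultimately have "linked ((\<Union>i\<in>{m..<n}. A i) \<union> A n)"
      using Suc.prems(1)[of n] 3 IH by (intro linked_Un) auto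
    moreover have "(\<Union>i\<in>{m..<Suc n}. A i) = (\<Union>i\<in>{m..<n}. A i) \<union> A n"
      using 3 by (simp add: atLeastLessThanSuc Un_commute)
    ultimately show ?thesis by simp
  qed
qed

section \<open>Left translates of vertex sets\<close>

lemma l_coset_iff:
  assumes "g \<in> carrier G" "A \<subseteq> carrier G" "y \<in> carrier G"
  shows "y \<in> g <# A \<longleftrightarrow> inv g \<otimes> y \<in> A"
proof
  assume "y \<in> g <# A"
  then show "inv g \<otimes> y \<in> A" using assms by (auto simp: l_coset_def m_assoc[symmetric] subset_iff)
next
  assume "inv g \<otimes> y \<in> A"
  then have "g \<otimes> (inv g \<otimes> y) \<in> g <# A" by (auto simp: l_coset_def)
  then show "y \<in> g <# A" using assms by (simp add: m_assoc[symmetric])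
qed

lemma l_coset_mem: "x \<in> A \<Longrightarrow> g \<otimes> x \<in> g <# A"
  by (auto simp: l_coset_def)

lemma l_coset_mono: "A \<subseteq> B \<Longrightarrow> g <# A \<subseteq> g <# B"
  by (auto simp: l_coset_def)

lemma l_coset_Un: "g <# (A \<union> B) = (g <# A) \<union> (g <# B)"
  by (auto simp: l_coset_def)

lemma l_coset_mult:
  "g \<in> carrier G \<Longrightarrow> h \<in> carrier G \<Longrightarrow> A \<subseteq> carrier G \<Longrightarrow> g <# (h <# A) = (g \<otimes> h) <# A"
  by (rule lcos_m_assoc)

lemma l_coset_cancel [simp]:
  "g \<in> carrier G \<Longrightarrow> A \<subseteq> carrier G \<Longrightarrow> inv g <# (g <# A) = A"
  "g \<in> carrier G \<Longrightarrow> A \<subseteq> carrier G \<Longrightarrow> g <# (inv g <# A) = A"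
  by (simp_all add: l_coset_mult lcos_mult_one)

lemma l_coset_closed: "g \<in> carrier G \<Longrightarrow> A \<subseteq> carrier G \<Longrightarrow> g <# A \<subseteq> carrier G"
  by (auto simp: l_coset_def)

lemma l_coset_Int:
  assumes "g \<in> carrier G" "A \<subseteq> carrier G" "B \<subseteq> carrier G"
  shows "g <# (A \<inter> B) = (g <# A) \<inter> (g <# B)"
proof -
  have "inj_on ((\<otimes>) g) (carrier G)" using assms by (simp add: inj_on_multc inj_on_def)
  moreover have "g <# X = (\<otimes>) g ` X" for X by (auto simp: l_coset_def)
  ultimately show ?thesis using assms by (simp add: inj_on_image_Int)
qed

lemma l_coset_empty_iff: "g <# A = {} \<longleftrightarrow> A = {}"
  by (auto simp: l_coset_def)

lemma finite_l_coset: "finite A \<Longrightarrow> finite (g <# A)"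
  by (auto simp: l_coset_def)

lemma conn_translate:
  assumes "conn T x y" "g \<in> carrier G"
  shows "conn (g <# T) (g \<otimes> x) (g \<otimes> y)"
  using assms(1)
proof (induction rule: conn_induct)
  case (step y z)
  have "conn (g <# T) (g \<otimes> y) (g \<otimes> z)"
    using step assms by (intro conn_step adj_translate l_coset_mem) auto
  then show ?case using step conn_trans by blast
qed simp

lemma linked_translate:
  assumes "linked T" "g \<in> carrier G"
  shows "linked (g <# T)"
proof -
  have "conn (g <# T) x y" if xy: "x \<in> g <# T" "y \<in> g <# T" for x y
  proof -
    obtain x' y' where "x' \<in> T" "y' \<in> T" "x = g \<otimes> x'" "y = g \<otimes> y'"
      using xy unfolding l_coset_def by blast
    then show ?thesis using assms conn_translate by (auto simp: linked_def)
  qed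
  moreover have "g <# T \<subseteq> carrier G" using assms l_coset_closed by (simp add: linked_def)
  ultimately show ?thesis by (simp add: linked_def)
qed

lemma linked_carrier: "linked (carrier G)"
proof (rule linkedI[of _ \<one>])
  fix y assume y: "y \<in> carrier G"
  have *: "y \<in> generate G S \<Longrightarrow> conn (carrier G) \<one> y" for y
  proof (induction rule: generate.induct)
    case (incl h)
    then show ?case using S_subset by (intro conn_step) (auto simp: cayley_adj_def subset_iff intro!: bexI[of _ h])
  next
    case (inv h)
    then show ?case using S_subset
      by (intro conn_step) (auto simp: cayley_adj_def subset_iff intro!: bexI[of _ h])
  next
    case (eng h1 h2)
    then have h: "h1 \<in> carrier G" "h2 \<in> carrier G" using generate_S by auto
    have "conn (h1 <# carrier G) (h1 \<otimes> \<one>) (h1 \<otimes> h2)"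
      using eng h by (intro conn_translate) auto
    then have "conn (carrier G) h1 (h1 \<otimes> h2)" 
      using h conn_mono[OF _ l_coset_closed] by fastforce
    then show ?case using eng conn_trans by blast
  qed simp
  show "conn (carrier G) \<one> y" using * y generate_S by simp
qed simp

lemma linked_finite_superset:
  assumes "linked T" "finite F" "F \<noteq> {}" "F \<subseteq> T"
  shows "\<exists>T'\<subseteq>T. finite T' \<and> linked T' \<and> F \<subseteq> T'"
  using assms(2-4)
proof (induction rule: finite_ne_induct)
  case (singleton x)
  then show ?case using assms(1) by (intro exI[of _ "{x}"]) (auto simp: linked_def)
next
  case (insert x F)
  then obtain T' where T': "T' \<subseteq> T" "finite T'" "linked T'" "F \<subseteq> T'" by auto
  obtain z where z: "z \<in> F" using insert by blast
  have "conn T z x" "z \<in> T" "T \<subseteq> carrier G" using z insert assms by (auto simp: linked_def)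
  then obtain U where U: "U \<subseteq> T" "finite U" "linked U" "z \<in> U" "x \<in> U"
    using conn_finite[of T z x] by blast
  have "linked (T' \<union> U)" using T' U z by (intro linked_Un) auto
  then show ?case using T' U by (intro exI[of _ "T' \<union> U"]) auto
qed

text \<open>Follow the path: either it has avoided \<open>B\<close> so far, or its first edge into
  \<open>B\<close> has been passed.\<close>

lemma conn_first_hit:
  assumes "conn T x y" "x \<in> T" "x \<notin> B" "y \<in> B"
  shows "\<exists>z z'. conn (T - B) x z \<and> z \<in> T - B \<and> adj z z' \<and> z' \<in> T \<inter> B"
proof -
  have "conn (T - B) x y \<and> y \<in> T - B \<or> (\<exists>z z'. conn (T - B) x z \<and> z \<in> T - B \<and> adj z z' \<and> z' \<in> T \<inter> B)"
    using assms(1)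
  proof (induction rule: conn_induct)
    case (step y z)
    then show ?case using conn_trans[OF _ conn_step[of y "T - B" z]] by blast
  qed (use assms in auto)
  then show ?thesis using assms by blast
qed

section \<open>Components of the complement of a cut set\<close>

lemma comp_linked: "comp K C \<Longrightarrow> linked C"
  and comp_nonempty: "comp K C \<Longrightarrow> C \<noteq> {}"
  and comp_disjoint: "comp K C \<Longrightarrow> C \<inter> K = {}"
  and comp_closed: "comp K C \<Longrightarrow> C \<subseteq> carrier G"
  by (auto simp: comp_def linked_def)

lemma comp_max:
  "comp K C \<Longrightarrow> linked T \<Longrightarrow> T \<inter> K = {} \<Longrightarrow> T \<inter> C \<noteq> {} \<Longrightarrow> T \<subseteq> C"
  by (auto simp: comp_def)

lemma comp_eq: "comp K C \<Longrightarrow> comp K D \<Longrightarrow> C \<inter> D \<noteq> {} \<Longrightarrow> C = D"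
  using comp_max[of K C D] comp_max[of K D C] comp_linked[of K C] comp_linked[of K D]
    comp_disjoint[of K C] comp_disjoint[of K D] by blast

lemma comp_cayley_component:
  assumes "x \<in> carrier G - K"
  shows "comp K (cayley_component G S K x)"
proof -
  let ?C = "cayley_component G S K x"
  have C: "?C = {y. conn (- K) x y}" by (simp add: cayley_component_def conn_def)
  have sub: "?C \<subseteq> carrier G - K"
  proof
    fix y assume "y \<in> ?C"
    then have "conn (- K) x y" by (simp add: C)
    then show "y \<in> carrier G - K"
      by (induction rule: conn_induct) (use assms in \<open>auto simp: cayley_adj_def\<close>)
  qed
  have inner: "conn ?C x y" if "conn (- K) x y" for y
    using that
  proof (induction rule: conn_induct)
    case (step y z)
    then have "conn (- K) x z" by (intro conn_trans[OF _ conn_step[of y _ z]]) auto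
    then have "conn ?C y z" using step by (intro conn_step) (auto simp: C)
    then show ?case using step(5) by (rule conn_trans[rotated])
  qed simp
  have "linked ?C"
    using sub inner by (intro linkedI[of _ x]) (auto simp: C)
  moreover have "T \<subseteq> ?C" if T: "linked T" "T \<inter> K = {}" "T \<inter> ?C \<noteq> {}" for T
  proof
    fix y assume y: "y \<in> T"
    obtain z where z: "z \<in> T" "conn (- K) x z" using T(3) C by blast
    have "conn T z y" using T z y by (auto simp: linked_def)
    then have "conn (- K) z y" using T by (auto intro: conn_mono)
    then show "y \<in> ?C" using z(2) by (auto simp: C intro: conn_trans)
  qed
  moreover have "x \<in> ?C" by (simp add: C)
  moreover have "?C \<inter> K = {}" using sub by blast
  ultimately show ?thesis unfolding comp_def by blast
qed

lemma comp_exists: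
  assumes "x \<in> carrier G" "x \<notin> K"
  obtains C where "comp K C" "x \<in> C"
proof
  show "comp K (cayley_component G S K x)" using assms comp_cayley_component by blast
  show "x \<in> cayley_component G S K x" by (simp add: cayley_component_def)
qed

text \<open>The Cayley graph is connected, so some path leads from \<open>C\<close> to
  \<open>K\<close>. Its last vertex before entering \<open>K\<close> still lies in \<open>C\<close>
  by maximality, and the entering edge attaches \<open>C\<close> to \<open>K\<close>.\<close>

lemma comp_Un_linked:
  assumes "comp K C" "linked K" "K \<noteq> {}"
  shows "linked (K \<union> C)"
proof -
  obtain x y where xy: "x \<in> C" "y \<in> K" using assms comp_nonempty by blast
  have "conn (carrier G) x y"
    using linked_carrier assms(2) xy comp_closed[OF assms(1)] unfolding linked_def by blast
  then obtain z z' where z: "conn (carrier G - K) x z" "z \<in> carrier G - K" "adj z z'" "z' \<in> K"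
    using conn_first_hit[of "carrier G" x y K] xy comp_closed[OF assms(1)] comp_disjoint[OF assms(1)]
    by blast
  obtain U where U: "U \<subseteq> carrier G - K" "linked U" "x \<in> U" "z \<in> U"
    using conn_finite[OF z(1)] xy comp_closed[OF assms(1)] comp_disjoint[OF assms(1)] by blast
  then have "z \<in> C" using comp_max[OF assms(1), of U] xy by blast
  have zz: "conn (K \<union> C) z z'" using z \<open>z \<in> C\<close> by (intro conn_step) auto
  show ?thesis
  proof (rule linkedI[of _ z])
    show "K \<union> C \<subseteq> carrier G" using assms comp_closed by (auto simp: linked_def)
    fix y assume "y \<in> K \<union> C"
    then show "conn (K \<union> C) z y"
    proof
      assume "y \<in> K"
      then have "conn K z' y" using assms z by (auto simp: linked_def)
      then show ?thesis using zz by (auto intro: conn_trans conn_mono)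
    next
      assume "y \<in> C"
      then have "conn C z y" using comp_linked[OF assms(1)] \<open>z \<in> C\<close> by (auto simp: linked_def)
      then show ?thesis by (rule conn_mono) blast
    qed
  qed
qed

text \<open>Left multiplication is a graph automorphism, since edges are right multiplications by
  generators.\<close>

lemma comp_translate:
  assumes "comp K C" "g \<in> carrier G" "K \<subseteq> carrier G"
  shows "comp (g <# K) (g <# C)"
  unfolding comp_def
proof (intro conjI allI impI)
  show "linked (g <# C)" using assms comp_linked linked_translate by blast
  show "g <# C \<noteq> {}" using assms comp_nonempty by (simp add: l_coset_empty_iff)
  show "(g <# C) \<inter> (g <# K) = {}"
    using assms comp_closed comp_disjoint by (simp flip: l_coset_Int add: l_coset_empty_iff)
  fix T assume T: "linked T" "T \<inter> (g <# K) = {}" "T \<inter> (g <# C) \<noteq> {}"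
  have Tc: "T \<subseteq> carrier G" using T by (simp add: linked_def)
  have 1: "(inv g <# T) \<inter> D = inv g <# (T \<inter> (g <# D))" if "D \<subseteq> carrier G" for D
    using that assms Tc by (simp add: l_coset_Int l_coset_closed)
  have "inv g <# T \<subseteq> C"
  proof (rule comp_max[OF assms(1)])
    show "linked (inv g <# T)" using T assms linked_translate by simp
    show "(inv g <# T) \<inter> K = {}" using 1[of K] T assms by (simp add: l_coset_empty_iff)
    show "(inv g <# T) \<inter> C \<noteq> {}" using 1[of C] T assms comp_closed by (simp add: l_coset_empty_iff)
  qed
  then have "g <# (inv g <# T) \<subseteq> g <# C" by (rule l_coset_mono)
  then show "T \<subseteq> g <# C" using Tc assms by simp
qed

lemma comp_separates:
  assumes "comp K C" "x \<in> C" "y \<notin> C" "linked T" "x \<in> T" "y \<in> T"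
  shows "T \<inter> K \<noteq> {}"
  using comp_max[OF assms(1,4)] assms by blast

text \<open>\<open>E\<close> hangs on \<open>K\<close>, and \<open>K \<union> E\<close> avoids
  \<open>K'\<close>, which lies in the other component \<open>H\<close>. As a connected set meeting
  \<open>H'\<close> it cannot leave \<open>H'\<close>.\<close>

lemma comp_nested:
  assumes "linked K" "K \<noteq> {}" "comp K H" "comp K' H'" "K \<subseteq> H'" "K' \<subseteq> H"
    and "comp K E" "E \<noteq> H"
  shows "E \<subseteq> H'"
proof -
  have "linked (K \<union> E)" using assms by (intro comp_Un_linked)
  moreover have "E \<inter> H = {}" using comp_eq[OF assms(7,3)] assms(8) by blast
  moreover have "K \<inter> K' = {}" using assms(6) comp_disjoint[OF assms(3)] by blast
  ultimately have "K \<union> E \<subseteq> H'" using assms(2,5,6) comp_max[OF assms(4), of "K \<union> E"] by blast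
  then show ?thesis by blast
qed

end

section \<open>Nested translates of a finite cut set\<close>

context group
begin

text \<open>\<open>g \<otimes> a = b\<close> forces \<open>g = b \<otimes> inv a\<close>. The bounds
  on overlaps of axes and on the defect come from this count.\<close>

lemma finite_meeting:
  assumes "finite A" "finite B" "A \<subseteq> carrier G" "B \<subseteq> carrier G"
  shows "finite {g \<in> carrier G. (g <# A) \<inter> B \<noteq> {}}"
    and "card {g \<in> carrier G. (g <# A) \<inter> B \<noteq> {}} \<le> card A * card B"
proof -
  have sub: "{g \<in> carrier G. (g <# A) \<inter> B \<noteq> {}} \<subseteq> (\<lambda>(a, b). b \<otimes> inv a) ` (A \<times> B)"
  proof
    fix g assume "g \<in> {g \<in> carrier G. (g <# A) \<inter> B \<noteq> {}}"
    then obtain a where a: "g \<in> carrier G" "a \<in> A" "g \<otimes> a \<in> B"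
      unfolding l_coset_def by blast
    moreover have "a \<in> carrier G" using a(2) assms(3) by blast
    ultimately have "(g \<otimes> a) \<otimes> inv a = g" using a(1) by (simp add: m_assoc)
    then show "g \<in> (\<lambda>(a, b). b \<otimes> inv a) ` (A \<times> B)"
      using a by (intro image_eqI[of _ _ "(a, g \<otimes> a)"]) simp_all
  qed
  then show "finite {g \<in> carrier G. (g <# A) \<inter> B \<noteq> {}}"
    by (rule finite_subset) (use assms(1,2) in simp)
  have "card {g \<in> carrier G. (g <# A) \<inter> B \<noteq> {}} \<le> card ((\<lambda>(a, b). b \<otimes> inv a) ` (A \<times> B))"
    using sub assms by (intro card_mono) auto
  also have "\<dots> \<le> card (A \<times> B)" using assms by (intro card_image_le) auto
  finally show "card {g \<in> carrier G. (g <# A) \<inter> B \<noteq> {}} \<le> card A * card B"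
    by (simp add: card_cartesian_product)
qed

lemma pow_conj_iterate:
  assumes "x \<in> carrier G" "g \<in> carrier G" "z \<in> carrier G" "x [^] (n::nat) \<otimes> g = g \<otimes> z [^] (m::nat)"
  shows "x [^] (n * N) \<otimes> g = g \<otimes> z [^] (m * N)"
proof (induction N)
  case (Suc N)
  have "x [^] (n * Suc N) \<otimes> g = (x [^] n \<otimes> x [^] (n * N)) \<otimes> g"
    using assms(1) by (simp add: nat_pow_mult)
  also have "\<dots> = x [^] n \<otimes> (x [^] (n * N) \<otimes> g)"
    using assms(1-3) by (intro m_assoc) auto
  also have "\<dots> = x [^] n \<otimes> (g \<otimes> z [^] (m * N))"
    by (simp only: Suc)
  also have "\<dots> = (x [^] n \<otimes> g) \<otimes> z [^] (m * N)"
    using assms(1-3) by (intro m_assoc[symmetric]) auto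
  also have "\<dots> = (g \<otimes> z [^] m) \<otimes> z [^] (m * N)"
    by (simp only: assms(4))
  also have "\<dots> = g \<otimes> (z [^] m \<otimes> z [^] (m * N))"
    using assms(1-3) by (intro m_assoc) auto
  also have "\<dots> = g \<otimes> z [^] (m * Suc N)"
    using assms(3) by (simp add: nat_pow_mult)
  finally show ?case .
qed (use assms in simp)

text \<open>Commensurability up to conjugation and inversion. The exponent \<open>m\<close> may be
  zero here; if \<open>x\<close> has infinite order this cannot happen, and the relation can be
  reversed.\<close>

definition commens :: "'a \<Rightarrow> 'a \<Rightarrow> bool" where
  "commens x y \<longleftrightarrow> (\<exists>n m g z. 0 < (n::nat) \<and> g \<in> carrier G \<and> (z = y \<or> z = inv y) \<and>
     x [^] n \<otimes> g = g \<otimes> z [^] (m::nat))"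

end

section \<open>Tubes around the powers of an element\<close>

context cayley_graph
begin

text \<open>A finite stretch of the axis of \<open>z\<close>, thickened by \<open>T\<close>. If
  \<open>T\<close> contains \<open>\<one>\<close> and \<open>z\<close>, consecutive translates share
  a vertex.\<close>

definition tube :: "'a set \<Rightarrow> 'a \<Rightarrow> nat \<Rightarrow> 'a set" where
  "tube T z n = (\<Union>j\<in>{0..<n}. z [^] j <# T)"

lemma linked_tube:
  assumes "linked T" "\<one> \<in> T" "z \<in> T"
  shows "linked (tube T z n)"
  unfolding tube_def
proof (rule linked_UN_interval)
  have z: "z \<in> carrier G" using assms linked_carrierD by blast
  fix i :: nat
  show "linked (z [^] i <# T)" using assms z linked_translate by simp
  have "z [^] i \<otimes> z \<in> z [^] i <# T" "z [^] Suc i \<otimes> \<one> \<in> z [^] Suc i <# T"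
    using assms by (auto intro: l_coset_mem simp del: nat_pow_Suc)
  then show "(z [^] i <# T) \<inter> (z [^] Suc i <# T) \<noteq> {}" using z by auto
qed

text \<open>Only exponents below \<open>n\<close> occur in the tube; the end value
  \<open>j = n\<close> is reached through the translate at \<open>n - 1\<close>, because
  \<open>T\<close> contains \<open>z <# A\<close> as well.\<close>

lemma tube_translate:
  assumes "z \<in> carrier G" "T \<subseteq> carrier G" "j \<le> n" "0 < n" "A \<subseteq> T" "z <# A \<subseteq> T"
  shows "z [^] j <# A \<subseteq> tube T z n"
proof (cases "j < n")
  case True
  then show ?thesis using l_coset_mono[OF assms(5)] by (fastforce simp: tube_def)
next
  case False
  then have j: "j = Suc (n - 1)" "n - 1 < n" using assms by auto
  have "z [^] j <# A = z [^] (n - 1) <# (z <# A)"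
    unfolding j(1) using assms(1,2,5) by (subst l_coset_mult) auto
  also have "\<dots> \<subseteq> z [^] (n - 1) <# T" by (rule l_coset_mono) fact
  finally show ?thesis using j by (auto simp: tube_def)
qed

lemma pow_in_tube:
  assumes "linked T" "\<one> \<in> T" "z \<in> T" "j \<le> n" "0 < n"
  shows "z [^] j \<in> tube T z n"
proof -
  have "z \<in> carrier G" using assms linked_carrierD by blast
  then show ?thesis
    using tube_translate[of z T j n "{\<one>}"] assms linked_carrierD
    by (auto simp: l_coset_def linked_def)
qed

lemma l_coset_tube:
  "g \<in> carrier G \<Longrightarrow> z \<in> carrier G \<Longrightarrow> T \<subseteq> carrier G \<Longrightarrow>
    g <# tube T z n = (\<Union>j\<in>{0..<n}. (g \<otimes> z [^] j) <# T)"
proof -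
  assume a: "g \<in> carrier G" "z \<in> carrier G" "T \<subseteq> carrier G"
  have "g <# tube T z n = (\<Union>j\<in>{0..<n}. g <# (z [^] j <# T))"
    unfolding tube_def by (auto simp: l_coset_def)
  also have "\<dots> = (\<Union>j\<in>{0..<n}. (g \<otimes> z [^] j) <# T)" using a by (simp add: l_coset_mult)
  finally show ?thesis .
qed

end

section \<open>Elements that move the cut set off itself\<close>

locale cut = cayley_graph +
  fixes K
  assumes finite_K: "finite K" and linked_K: "linked K" and one_K: "\<one> \<in> K"
begin

lemma K_closed: "K \<subseteq> carrier G"
  using linked_K by (simp add: linked_def)

lemma K_nonempty: "K \<noteq> {}"
  using one_K by blast

text \<open>\<open>Q\<close> is the component that contains \<open>inv x <# K\<close>. When
  \<open>P \<noteq> Q\<close>, such an \<open>x\<close> acts like a hyperbolic translation from the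
  \<open>Q\<close> side to the \<open>P\<close> side.\<close>

definition moves :: "'a \<Rightarrow> 'a set \<Rightarrow> 'a set \<Rightarrow> bool" where
  "moves x P Q \<longleftrightarrow> x \<in> carrier G \<and> comp K P \<and> comp K Q \<and> x <# K \<subseteq> P \<and> K \<subseteq> x <# Q"

lemma moves_inv: "moves x P Q \<Longrightarrow> moves (inv x) Q P"
proof -
  assume t: "moves x P Q"
  then have x: "x \<in> carrier G" and PQ: "P \<subseteq> carrier G" "Q \<subseteq> carrier G"
    using comp_closed[of K P] comp_closed[of K Q] by (simp_all add: moves_def)
  have "inv x <# K \<subseteq> inv x <# (x <# Q)" "inv x <# (x <# K) \<subseteq> inv x <# P"
    using t by (auto simp: moves_def intro!: l_coset_mono)
  then show ?thesis using t x PQ K_closed by (simp add: moves_def)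
qed

text \<open>The ping-pong step: \<open>x <# Q\<close> is the component of the complement of
  \<open>x <# K\<close> that contains \<open>K\<close>, so by \<open>comp_nested\<close> every other
  one falls into \<open>P\<close>.\<close>

lemma moves_push:
  assumes "moves x P Q" "comp K E" "E \<noteq> Q"
  shows "x <# E \<subseteq> P"
proof -
  have x: "x \<in> carrier G" "comp K P" "comp K Q" "x <# K \<subseteq> P" "K \<subseteq> x <# Q"
    using assms(1) by (auto simp: moves_def)
  have "x <# E \<noteq> x <# Q"
  proof
    assume "x <# E = x <# Q"
    then have "inv x <# (x <# E) = inv x <# (x <# Q)" by simp
    then show False using x(1) assms(3) comp_closed[OF assms(2)] comp_closed[OF x(3)] by simp
  qed
  then show ?thesis
    using comp_nested[of "x <# K" "x <# Q" K P "x <# E"] linked_translate[OF linked_K x(1)]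
      comp_translate[OF x(3,1) K_closed] comp_translate[OF assms(2) x(1) K_closed] x K_nonempty
    by (simp add: l_coset_empty_iff)
qed

text \<open>Because \<open>R\<close> differs from \<open>Q\<close>, \<open>x\<close> pushes
  \<open>R\<close>, and with it \<open>y <# K\<close>, into \<open>P\<close>. Symmetrically
  \<open>inv y\<close> pushes \<open>Q\<close> into \<open>T\<close>, so \<open>x <# Q\<close>,
  which contains \<open>K\<close>, lies in \<open>x \<otimes> y <# T\<close>.\<close>

lemma moves_mult:
  assumes "moves x P Q" "moves y R T" "Q \<noteq> R"
  shows "moves (x \<otimes> y) P T"
proof -
  have c: "x \<in> carrier G" "y \<in> carrier G" "Q \<subseteq> carrier G" "T \<subseteq> carrier G"
    using assms(1,2) comp_closed[of K Q] comp_closed[of K T] by (simp_all add: moves_def)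
  have "x <# (y <# K) \<subseteq> x <# R" using assms by (auto simp: moves_def intro!: l_coset_mono)
  moreover have "x <# R \<subseteq> P" using moves_push[OF assms(1)] assms by (auto simp: moves_def)
  ultimately have 1: "(x \<otimes> y) <# K \<subseteq> P" using c K_closed by (simp add: l_coset_mult)
  have "inv y <# Q \<subseteq> T" using moves_push[OF moves_inv[OF assms(2)]] assms by (auto simp: moves_def)
  then have "y <# (inv y <# Q) \<subseteq> y <# T" by (rule l_coset_mono)
  then have "x <# Q \<subseteq> x <# (y <# T)" using c by (intro l_coset_mono) simp
  then have "x <# Q \<subseteq> (x \<otimes> y) <# T" using c by (simp add: l_coset_mult)
  then have "K \<subseteq> (x \<otimes> y) <# T" using assms(1) by (auto simp: moves_def)
  then show ?thesis using 1 assms c by (simp add: moves_def)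
qed

text \<open>\<open>K\<close> is connected and disjoint from \<open>x <# K\<close>, hence inside one
  component of its complement; pulled back by \<open>x\<close>, this is \<open>Q\<close>.\<close>

lemma moves_exists:
  assumes "x \<in> carrier G" "comp K P" "x <# K \<subseteq> P"
  obtains Q where "moves x P Q"
proof -
  have "K \<inter> (x <# K) = {}" using assms(3) comp_disjoint[OF assms(2)] by blast
  then have d: "\<one> \<notin> x <# K" using one_K by blast
  obtain C where C: "comp (x <# K) C" "\<one> \<in> C"
    using comp_exists[OF one_closed d] by blast
  have "K \<subseteq> C"
    using comp_max[OF C(1) linked_K] one_K C(2) \<open>K \<inter> (x <# K) = {}\<close> by blast
  moreover have "comp K (inv x <# C)"
    using comp_translate[OF C(1), of "inv x"] assms K_closed l_coset_closed by simp
  moreover have "x <# (inv x <# C) = C" using assms(1) comp_closed[OF C(1)] by simp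
  ultimately have "moves x P (inv x <# C)" using assms by (simp add: moves_def)
  then show thesis by (rule that)
qed

text \<open>If each of the two elements returns to its own component, their product serves, just as
  two reflections compose to a translation.\<close>

lemma moves_exists_distinct:
  assumes "C1 \<noteq> C2" "x1 \<in> carrier G" "comp K C1" "x1 <# K \<subseteq> C1"
    and "x2 \<in> carrier G" "comp K C2" "x2 <# K \<subseteq> C2"
  obtains s I J where "moves s I J" "I \<noteq> J"
proof -
  obtain D1 D2 where D: "moves x1 C1 D1" "moves x2 C2 D2"
    using moves_exists assms by metis
  consider "D1 \<noteq> C1" | "D2 \<noteq> C2" | "D1 = C1" "D2 = C2" by blast
  then show thesis
  proof cases
    case 3
    then have "moves (x1 \<otimes> x2) C1 C2" using moves_mult[OF D] assms by simp
    then show thesis using that assms by blast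
  qed (use D that in metis)+
qed

text \<open>\<open>s\<close> translates between \<open>I\<close> and \<open>J\<close>, and
  \<open>t\<close> branches off into the third component \<open>C\<close>. Of two words with the
  same first letter, one continues inside the old component and the other passes through
  \<open>C\<close>, so their images are disjoint.\<close>

lemma ping_pong_pair:
  assumes s: "moves s I J" "I \<noteq> J" and t: "moves t C D" "C \<noteq> I" "C \<noteq> J"
  shows "\<exists>P Q a b. P \<noteq> Q \<and> moves a P Q \<and> moves b P Q \<and> (a <# P) \<inter> (b <# P) = {}"
proof -
  have comps: "comp K I" "comp K J" "comp K C" "s \<in> carrier G" "t \<in> carrier G"
    using s(1) t(1) by (simp_all add: moves_def)
  have key: "(u \<otimes> v <# E) \<inter> (u \<otimes> w <# E) = {}"
    if "u \<in> carrier G" "v \<in> carrier G" "w \<in> carrier G" "comp K E" "v <# E \<subseteq> E" "w <# E \<subseteq> C" "E \<noteq> C"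
    for u v w E
  proof -
    have "E \<inter> C = {}" using comp_eq[OF that(4) comps(3)] that(7) by blast
    then have "(u <# E) \<inter> (u <# C) = {}"
      using that comps comp_closed by (simp flip: l_coset_Int add: l_coset_empty_iff)
    moreover have "u \<otimes> v <# E \<subseteq> u <# E" "u \<otimes> w <# E \<subseteq> u <# C"
      using that comp_closed by (auto simp flip: l_coset_mult intro!: l_coset_mono)
    ultimately show ?thesis by blast
  qed
  show ?thesis
  proof (cases "D = I")
    case False
    have ts: "moves (t \<otimes> s) C J" using moves_mult[OF t(1) s(1)] False by simp
    have "moves (s \<otimes> s) I J" "moves (s \<otimes> (t \<otimes> s)) I J"
      using moves_mult[OF s(1) s(1)] moves_mult[OF s(1) ts] s t by auto
    moreover have "(s \<otimes> s <# I) \<inter> (s \<otimes> (t \<otimes> s) <# I) = {}"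
      using comps moves_push[OF s(1) comps(1) s(2)] moves_push[OF ts comps(1) s(2)] t(2)
      by (intro key) auto
    ultimately show ?thesis using s(2) by blast
  next
    \<comment> \<open>Now \<open>moves_mult\<close> does not apply to \<open>t\<close> and
      \<open>s\<close>. Replacing \<open>s\<close> by its inverse exchanges \<open>I\<close> and
      \<open>J\<close>, and \<open>J\<close> differs from \<open>D\<close>.\<close>
    case True
    have si: "moves (inv s) J I" using moves_inv s by simp
    have "moves (inv s \<otimes> inv s) J I" "moves (inv s \<otimes> t) J I"
      using moves_mult[OF si si] moves_mult[OF si t(1)] True s t by auto
    moreover have "(inv s \<otimes> inv s <# J) \<inter> (inv s \<otimes> t <# J) = {}"
      using comps moves_push[OF si comps(2)] moves_push[OF t(1) comps(2)] t(3) s(2) True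
      by (intro key) auto
    ultimately show ?thesis using s(2) by blast
  qed
qed

end

section \<open>The ping-pong semigroup, its order and the axes of its elements\<close>

locale ping_pong = cut +
  fixes P Q
  assumes comp_P: "comp K P" and comp_Q: "comp K Q" and P_noteq_Q: "P \<noteq> Q"
begin

definition L :: "'a set" where
  "L = {x. moves x P Q}"

text \<open>A left-invariant strict order on the group, along which the translates of
  \<open>P\<close> decrease and those of \<open>Q\<close> increase. Words in elements of
  \<open>L\<close> trace increasing chains.\<close>

definition ahead :: "'a \<Rightarrow> 'a \<Rightarrow> bool" where
  "ahead e f \<longleftrightarrow> e \<in> carrier G \<and> f \<in> carrier G \<and> inv e \<otimes> f \<in> L"

lemma P_closed: "P \<subseteq> carrier G" and Q_closed: "Q \<subseteq> carrier G"
  using comp_closed comp_P comp_Q by auto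

lemma P_Int_Q: "P \<inter> Q = {}"
  using comp_eq[OF comp_P comp_Q] P_noteq_Q by blast

lemma L_closed: "x \<in> L \<Longrightarrow> x \<in> carrier G"
  by (simp add: L_def moves_def)

lemma L_K: "x \<in> L \<Longrightarrow> x <# K \<subseteq> P" and L_K': "x \<in> L \<Longrightarrow> K \<subseteq> x <# Q"
  by (simp_all add: L_def moves_def)

lemma L_P: "x \<in> L \<Longrightarrow> x <# P \<subseteq> P"
  using moves_push[of x P Q P] comp_P P_noteq_Q by (simp add: L_def)

lemma L_Q: "x \<in> L \<Longrightarrow> Q \<subseteq> x <# Q"
proof -
  assume x: "x \<in> L"
  have "inv x <# Q \<subseteq> Q"
    using moves_push[of "inv x" Q P Q] x comp_Q P_noteq_Q by (simp add: L_def moves_inv)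
  then have "x <# (inv x <# Q) \<subseteq> x <# Q" by (rule l_coset_mono)
  then show ?thesis using x L_closed Q_closed by simp
qed

lemma L_mult: "x \<in> L \<Longrightarrow> y \<in> L \<Longrightarrow> x \<otimes> y \<in> L"
  using moves_mult[of x P Q y P Q] P_noteq_Q by (simp add: L_def)

lemma L_pow: "x \<in> L \<Longrightarrow> 0 < n \<Longrightarrow> x [^] (n::nat) \<in> L"
proof (induction n)
  case (Suc n)
  then show ?case by (cases "n = 0") (auto simp: L_mult L_closed)
qed simp

lemma one_notin_P: "\<one> \<notin> P" and one_notin_Q: "\<one> \<notin> Q"
  using one_K comp_disjoint comp_P comp_Q by auto

lemma L_in_P: "x \<in> L \<Longrightarrow> x \<in> P"
  using L_K l_coset_mem[OF one_K, of x] L_closed by auto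

lemma L_ne_one: "\<one> \<notin> L"
  using L_in_P one_notin_P by blast

lemma L_pow_inj: "x \<in> L \<Longrightarrow> x [^] (i::nat) = x [^] (j::nat) \<Longrightarrow> i = j"
proof (induction i j rule: linorder_wlog)
  case (le i j)
  have c: "x \<in> carrier G" using le L_closed by simp
  have "x [^] i \<otimes> x [^] (j - i) = x [^] i \<otimes> \<one>" using c le(1) le(3)[symmetric] by (simp add: nat_pow_mult)
  then have "x [^] (j - i) = \<one>" using c by (subst (asm) Units_l_cancel) auto
  then have "\<not> 0 < j - i" using L_pow[OF le(2)] L_ne_one by metis
  then show ?case using le by simp
qed simp

lemma aheadI: "e \<in> carrier G \<Longrightarrow> x \<in> L \<Longrightarrow> ahead e (e \<otimes> x)"
  by (simp add: ahead_def L_closed m_assoc[symmetric])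

lemma aheadE: 
  assumes "ahead e f"
  obtains x where "e \<in> carrier G" "x \<in> L" "f = e \<otimes> x"
proof -
  have "f = e \<otimes> (inv e \<otimes> f)" using assms by (simp add: ahead_def m_assoc[symmetric])
  then show thesis using assms that[of "inv e \<otimes> f"] unfolding ahead_def by blast
qed

lemma ahead_carrier: "ahead e f \<Longrightarrow> e \<in> carrier G" "ahead e f \<Longrightarrow> f \<in> carrier G"
  by (simp_all add: ahead_def)

lemma ahead_trans: "ahead e f \<Longrightarrow> ahead f h \<Longrightarrow> ahead e h"
proof -
  assume a: "ahead e f" "ahead f h"
  obtain x where x: "e \<in> carrier G" "x \<in> L" "f = e \<otimes> x" using a(1) by (rule aheadE)
  obtain y where y: "y \<in> L" "h = f \<otimes> y" using a(2) by (rule aheadE)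
  have "h = e \<otimes> (x \<otimes> y)" using x y L_closed by (simp add: m_assoc)
  then show "ahead e h" using x y L_mult aheadI by simp
qed

lemma ahead_subset:
  assumes "ahead e f"
  shows "f <# K \<subseteq> e <# P" "f <# P \<subseteq> e <# P" "e <# K \<subseteq> f <# Q" "e <# Q \<subseteq> f <# Q"
proof -
  obtain x where x: "e \<in> carrier G" "x \<in> L" "f = e \<otimes> x" using assms by (rule aheadE)
  have f: "f <# A = e <# (x <# A)" if "A \<subseteq> carrier G" for A
    using that x L_closed by (simp add: l_coset_mult)
  show "f <# K \<subseteq> e <# P" "f <# P \<subseteq> e <# P" "e <# K \<subseteq> f <# Q" "e <# Q \<subseteq> f <# Q"
    using l_coset_mono[OF L_K[OF x(2)], of e] l_coset_mono[OF L_P[OF x(2)], of e]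
      l_coset_mono[OF L_K'[OF x(2)], of e] l_coset_mono[OF L_Q[OF x(2)], of e]
      K_closed P_closed Q_closed by (simp_all add: f)
qed

text \<open>\<open>f <# P\<close> and \<open>f <# Q\<close> are different components of the
  complement of \<open>f <# K\<close>.\<close>

lemma crossing:
  assumes "f \<in> carrier G" "x \<in> f <# Q" "y \<in> f <# P" "linked T" "x \<in> T" "y \<in> T"
  shows "(f <# K) \<inter> T \<noteq> {}"
proof -
  have "(f <# P) \<inter> (f <# Q) = {}"
    using assms(1) P_closed Q_closed P_Int_Q by (simp flip: l_coset_Int add: l_coset_empty_iff)
  then have "T \<inter> (f <# K) \<noteq> {}"
    using assms comp_separates[OF comp_translate[OF comp_P assms(1) K_closed], of y x T] by blast
  then show ?thesis by blast
qed

lemma L_pow_eventually_disjoint: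
  assumes x: "x \<in> L" and AB: "finite A" "finite B" "A \<subseteq> carrier G" "B \<subseteq> carrier G"
  obtains N0 where "\<And>N. N0 \<le> N \<Longrightarrow> (x [^] (N::nat) <# A) \<inter> B = {}"
proof -
  let ?F = "{g \<in> carrier G. (g <# A) \<inter> B \<noteq> {}}"
  have "inj (\<lambda>N::nat. x [^] N)" using L_pow_inj[OF x] by (rule injI)
  then have "finite ((\<lambda>N::nat. x [^] N) -` ?F)"
    using finite_meeting(1)[OF AB] by (intro finite_vimageI)
  then obtain N0 where N0: "(\<lambda>N::nat. x [^] N) -` ?F \<subseteq> {..<N0}"
    using finite_nat_bounded by blast
  have "(x [^] N <# A) \<inter> B = {}" if "N0 \<le> N" for N
  proof (rule ccontr)
    assume "(x [^] N <# A) \<inter> B \<noteq> {}"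
    then have "N \<in> (\<lambda>N::nat. x [^] N) -` ?F" using L_closed[OF x] by simp
    then show False using N0 that by auto
  qed
  then show thesis by (rule that)
qed

text \<open>A finite connected set \<open>R\<close> joining \<open>\<one>\<close> to
  \<open>q\<close> is moved off \<open>K\<close> by high powers of \<open>x\<close>; as
  \<open>x [^] N\<close> itself lies in \<open>P\<close>, so does the whole translate.\<close>

lemma L_pow_eventually_P:
  assumes x: "x \<in> L" and q: "q \<in> carrier G"
  obtains N0 where "\<And>N. N0 \<le> N \<Longrightarrow> x [^] (N::nat) \<otimes> q \<in> P"
proof -
  obtain R where R: "finite R" "linked R" "\<one> \<in> R" "q \<in> R" "R \<subseteq> carrier G"
    using linked_finite_superset[OF linked_carrier, of "{\<one>, q}"] q by auto
  obtain N0 where N0: "\<And>N. N0 \<le> N \<Longrightarrow> (x [^] (N::nat) <# R) \<inter> K = {}"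
    using L_pow_eventually_disjoint[OF x R(1) finite_K R(5) K_closed] by blast
  show thesis
  proof (rule that[of "Suc N0"])
    fix N assume N: "Suc N0 \<le> N"
    have xN: "x [^] N \<in> L" using L_pow[OF x] N by simp
    have "x [^] N \<in> x [^] N <# R" using l_coset_mem[OF R(3), of "x [^] N"] xN L_closed by simp
    then have "x [^] N <# R \<subseteq> P"
      using comp_max[OF comp_P linked_translate[OF R(2) L_closed[OF xN]]] N0[of N] N L_in_P[OF xN]
      by auto
    then show "x [^] N \<otimes> q \<in> P" using l_coset_mem[OF R(4)] by blast
  qed
qed

lemma L_pow_eventually_Q:
  assumes x: "x \<in> L" and q: "q \<in> carrier G"
  obtains N :: nat where "inv (x [^] N) \<otimes> q \<in> Q"
proof -
  obtain R where R: "finite R" "linked R" "\<one> \<in> R" "q \<in> R" "R \<subseteq> carrier G"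
    using linked_finite_superset[OF linked_carrier, of "{\<one>, q}"] q by auto
  obtain N0 where N0: "\<And>N. N0 \<le> N \<Longrightarrow> (x [^] (N::nat) <# K) \<inter> R = {}"
    using L_pow_eventually_disjoint[OF x finite_K R(1) K_closed R(5)] by blast
  let ?y = "x [^] Suc N0"
  have y: "?y \<in> L" using L_pow[OF x] by blast
  have "R \<inter> (?y <# K) = {}" using N0[of "Suc N0"] by (simp add: Int_commute)
  moreover have "\<one> \<in> ?y <# Q" using L_K'[OF y] one_K by blast
  ultimately have "R \<subseteq> ?y <# Q"
    using comp_max[OF comp_translate[OF comp_Q L_closed[OF y] K_closed] R(2)] R(3) by blast
  then have "q \<in> ?y <# Q" using R(4) by blast
  then have "inv ?y \<otimes> q \<in> Q" using l_coset_iff[OF L_closed[OF y] Q_closed q] by blast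
  then show thesis by (rule that)
qed

text \<open>Cut a path from \<open>\<one>\<close> to \<open>x\<close> in \<open>K \<union> P\<close>
  where it first enters \<open>x <# K\<close>; up to there it stays in \<open>x <# Q\<close>.
  Confinement to the region between the two cuts later keeps segments of an axis on one side of a
  given cut.\<close>

lemma bridge_exists:
  assumes x: "x \<in> L"
  shows "\<exists>T. finite T \<and> linked T \<and> K \<union> (x <# K) \<subseteq> T \<and> T \<subseteq> K \<union> (x <# K) \<union> (P \<inter> (x <# Q))"
proof -
  have xc: "x \<in> carrier G" using x L_closed by simp
  let ?U = "K \<union> (x <# K) \<union> (P \<inter> (x <# Q))"
  have Kx: "K \<inter> (x <# K) = {}" using L_K[OF x] comp_disjoint[OF comp_P] by blast
  have cQ: "comp (x <# K) (x <# Q)" using comp_translate comp_Q xc K_closed by simp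
  have "linked (K \<union> P)" using comp_Un_linked[OF comp_P linked_K K_nonempty] .
  moreover have "x \<in> x <# K" using l_coset_mem[OF one_K, of x] xc by simp
  ultimately have "conn (K \<union> P) \<one> x" using one_K L_K[OF x] by (auto simp: linked_def)
  then obtain z z' where z: "conn (K \<union> P - (x <# K)) \<one> z" "z \<in> K \<union> P - (x <# K)" "adj z z'" "z' \<in> x <# K"
    using conn_first_hit[of "K \<union> P" \<one> x "x <# K"] one_K Kx \<open>x \<in> x <# K\<close> by blast
  have "K \<union> P - (x <# K) \<subseteq> carrier G" using K_closed P_closed by blast
  then obtain V where V: "V \<subseteq> K \<union> P - (x <# K)" "finite V" "linked V" "\<one> \<in> V" "z \<in> V"
    using conn_finite[OF z(1)] one_K Kx by blast
  have "\<one> \<in> x <# Q" using L_K'[OF x] one_K by blast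
  then have VQ: "V \<subseteq> x <# Q" using comp_max[OF cQ V(3)] V by blast
  have lz: "linked {z, z'}"
  proof (rule linkedI[of _ z])
    show "{z, z'} \<subseteq> carrier G" using z(3) by (simp add: cayley_adj_def)
    fix y assume "y \<in> {z, z'}"
    then show "conn {z, z'} z y" using z(3) by (auto intro: conn_step)
  qed
  have "linked (K \<union> V)" using linked_Un[OF linked_K V(3)] one_K V by blast
  then have "linked (K \<union> V \<union> {z, z'})" using linked_Un lz V by blast
  then have "linked (K \<union> V \<union> {z, z'} \<union> (x <# K))"
    using linked_Un[OF _ linked_translate[OF linked_K xc]] z(4) by blast
  moreover have "K \<union> V \<union> {z, z'} \<union> (x <# K) \<subseteq> ?U" using V VQ z by blast
  moreover have "finite (K \<union> V \<union> {z, z'} \<union> (x <# K))" using V finite_K finite_l_coset by blast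
  ultimately show ?thesis by (intro exI[of _ "K \<union> V \<union> {z, z'} \<union> (x <# K)"]) auto
qed

definition bridge :: "'a \<Rightarrow> 'a set" where
  "bridge x = (SOME T. finite T \<and> linked T \<and> K \<union> (x <# K) \<subseteq> T \<and> T \<subseteq> K \<union> (x <# K) \<union> (P \<inter> (x <# Q)))"

lemma bridge:
  assumes "x \<in> L"
  shows "finite (bridge x)" "linked (bridge x)" "K \<subseteq> bridge x" "x <# K \<subseteq> bridge x"
    "bridge x \<subseteq> K \<union> (x <# K) \<union> (P \<inter> (x <# Q))"
    "bridge x \<subseteq> carrier G" "\<one> \<in> bridge x" "x \<in> bridge x"
proof -
  have *: "finite (bridge x) \<and> linked (bridge x) \<and> K \<union> (x <# K) \<subseteq> bridge x
      \<and> bridge x \<subseteq> K \<union> (x <# K) \<union> (P \<inter> (x <# Q))"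
    unfolding bridge_def by (rule someI_ex[OF bridge_exists[OF assms]])
  then show "finite (bridge x)" "linked (bridge x)" "K \<subseteq> bridge x" "x <# K \<subseteq> bridge x"
    "bridge x \<subseteq> K \<union> (x <# K) \<union> (P \<inter> (x <# Q))" by auto
  show "bridge x \<subseteq> carrier G" using * by (simp add: linked_def)
  show "\<one> \<in> bridge x" using * one_K by blast
  have "x \<in> x <# K" using l_coset_mem[OF one_K, of x] assms L_closed by simp
  then show "x \<in> bridge x" using * by blast
qed

text \<open>A finite piece of the axis of \<open>x\<close>. For \<open>x \<in> L\<close> and
  \<open>0 < n\<close> it contains the cuts \<open>x [^] j <# K\<close> up to and including
  \<open>j = n\<close>.\<close>

definition seg :: "'a \<Rightarrow> nat \<Rightarrow> 'a set" where
  "seg x n = tube (bridge x) x n"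

lemma linked_seg: "x \<in> L \<Longrightarrow> linked (seg x n)"
  unfolding seg_def by (intro linked_tube bridge)

lemma seg_closed: "x \<in> L \<Longrightarrow> seg x n \<subseteq> carrier G"
  using linked_seg by (simp add: linked_def)

lemma cut_in_seg: "x \<in> L \<Longrightarrow> j \<le> n \<Longrightarrow> 0 < n \<Longrightarrow> x [^] j <# K \<subseteq> seg x n"
  unfolding seg_def by (intro tube_translate bridge) (auto simp: L_closed)

lemma cut_in_seg': 
  assumes "g \<in> carrier G" "x \<in> L" "j \<le> n" "0 < n"
  shows "g \<otimes> x [^] j <# K \<subseteq> g <# seg x n"
  using l_coset_mono[OF cut_in_seg[OF assms(2-4)], of g] assms L_closed K_closed
  by (simp add: l_coset_mult)

lemma l_coset_seg: "g \<in> carrier G \<Longrightarrow> x \<in> L \<Longrightarrow>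
    g <# seg x n = (\<Union>j\<in>{0..<n}. (g \<otimes> x [^] j) <# bridge x)"
  unfolding seg_def by (intro l_coset_tube bridge) (simp_all add: L_closed)

text \<open>The bridge lies in its two end cuts and the \<open>P\<close> side of the first one, and
  all three lie beyond \<open>f <# K\<close>.\<close>

lemma bridge_ahead:
  assumes "ahead f e" "x \<in> L"
  shows "e <# bridge x \<subseteq> f <# P"
proof -
  have e: "e \<in> carrier G" using assms ahead_carrier by simp
  have "e <# bridge x \<subseteq> e <# (K \<union> (x <# K) \<union> P)"
    using bridge(5)[OF assms(2)] by (intro l_coset_mono) blast
  also have "\<dots> = (e <# K) \<union> (e \<otimes> x <# K) \<union> (e <# P)"
    using e assms L_closed K_closed by (simp add: l_coset_Un l_coset_mult)
  also have "\<dots> \<subseteq> f <# P"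
    using ahead_subset[OF assms(1)] ahead_subset[OF ahead_trans[OF assms(1) aheadI[OF e assms(2)]]]
    by blast
  finally show ?thesis .
qed

lemma bridge_behind:
  assumes "ahead (e \<otimes> x) f" "x \<in> L" "e \<in> carrier G"
  shows "e <# bridge x \<subseteq> f <# Q"
proof -
  have "e <# bridge x \<subseteq> e <# (K \<union> (x <# K) \<union> (x <# Q))"
    using bridge(5)[OF assms(2)] by (intro l_coset_mono) blast
  also have "\<dots> = (e <# K) \<union> (e \<otimes> x <# K) \<union> (e \<otimes> x <# Q)"
    using assms L_closed K_closed Q_closed by (simp add: l_coset_Un l_coset_mult)
  also have "\<dots> \<subseteq> f <# Q"
    using ahead_subset[OF assms(1)] ahead_subset[OF ahead_trans[OF aheadI[OF assms(3,2)] assms(1)]]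
    by blast
  finally show ?thesis .
qed

lemma seg_ahead:
  assumes "ahead f e" "x \<in> L"
  shows "e <# seg x n \<subseteq> f <# P"
proof -
  have e: "e \<in> carrier G" using assms ahead_carrier by simp
  have "ahead f (e \<otimes> x [^] j)" for j :: nat
    using assms e ahead_trans[OF assms(1) aheadI[OF e L_pow[OF assms(2)]]] by (cases "j = 0") auto
  then show ?thesis
    using bridge_ahead[OF _ assms(2)] unfolding l_coset_seg[OF e assms(2)] by (intro UN_least) simp
qed

lemma seg_behind:
  assumes "ahead (e \<otimes> x [^] n) f" "x \<in> L" "e \<in> carrier G"
  shows "e <# seg x n \<subseteq> f <# Q"
proof -
  have "(e \<otimes> x [^] j) <# bridge x \<subseteq> f <# Q" if j: "j < n" for j
  proof (rule bridge_behind)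
    have "e \<otimes> x [^] j \<otimes> x = e \<otimes> x [^] Suc j" using assms L_closed by (simp add: m_assoc)
    moreover have "ahead (e \<otimes> x [^] Suc j) f"
    proof (cases "Suc j = n")
      case False
      have "x [^] Suc j \<otimes> x [^] (n - Suc j) = x [^] n"
        using assms(2) L_closed j by (subst nat_pow_mult) auto
      then have "e \<otimes> x [^] n = e \<otimes> x [^] Suc j \<otimes> x [^] (n - Suc j)"
        using assms(2,3) L_closed by (simp add: m_assoc del: nat_pow_Suc)
      then have "ahead (e \<otimes> x [^] Suc j) (e \<otimes> x [^] n)"
        using aheadI[of "e \<otimes> x [^] Suc j" "x [^] (n - Suc j)"] assms L_closed L_pow False j by simp
      then show ?thesis using ahead_trans assms(1) by blast
    qed (use assms(1) in auto)
    ultimately show "ahead (e \<otimes> x [^] j \<otimes> x) f" by simp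
  qed (use assms L_closed in auto)
  then show ?thesis unfolding l_coset_seg[OF assms(3,2)] by (intro UN_least) simp
qed

end

section \<open>Commensurability and overlap of axes\<close>

lemma Int_UN_nonempty_iff: "A \<inter> (\<Union>j\<in>J. X j) \<noteq> {} \<longleftrightarrow> (\<exists>j\<in>J. A \<inter> X j \<noteq> {})"
  by blast

context group
begin

text \<open>The equation says that \<open>x [^] d\<close> moves one point of a translated orbit of
  \<open>y\<close> to another. Cancelling the smaller power of \<open>y\<close> leaves a conjugacy;
  the sign of \<open>j' - j\<close> decides between \<open>y\<close> and
  \<open>inv y\<close>.\<close>

lemma commensI:
  assumes "x \<in> carrier G" "y \<in> carrier G" "g \<in> carrier G" "0 < d"
    and eq: "x [^] (d::nat) \<otimes> (g \<otimes> y [^] (j::nat)) = g \<otimes> y [^] (j'::nat)"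
  shows "commens x y"
proof (cases "j \<le> j'")
  case True
  have "x [^] d \<otimes> g \<otimes> y [^] j = g \<otimes> (y [^] (j' - j) \<otimes> y [^] j)"
    using assms True by (simp add: m_assoc nat_pow_mult)
  also have "\<dots> = g \<otimes> y [^] (j' - j) \<otimes> y [^] j"
    using assms(1-3) by (simp add: m_assoc)
  finally have "x [^] d \<otimes> g = g \<otimes> y [^] (j' - j)"
    using assms(1-3) by (subst (asm) right_cancel) auto
  then show ?thesis using assms(3,4) unfolding commens_def by blast
next
  case False
  have "x [^] d \<otimes> g \<otimes> y [^] (j - j') \<otimes> y [^] j' = x [^] d \<otimes> (g \<otimes> (y [^] (j - j') \<otimes> y [^] j'))"
    using assms(1-3) by (simp add: m_assoc)
  also have "\<dots> = g \<otimes> y [^] j'"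
    using assms False by (simp add: nat_pow_mult)
  finally have *: "x [^] d \<otimes> g \<otimes> y [^] (j - j') = g"
    using assms(1-3) by (subst (asm) right_cancel) auto
  have "x [^] d \<otimes> g = x [^] d \<otimes> g \<otimes> y [^] (j - j') \<otimes> inv (y [^] (j - j'))"
    using assms(1-3) by (simp add: m_assoc)
  also have "\<dots> = g \<otimes> inv y [^] (j - j')"
    using assms(2) by (simp only: *) (simp add: nat_pow_inv)
  finally show ?thesis using assms(3,4) unfolding commens_def by blast
qed

lemma commens_sym:
  assumes x: "x \<in> carrier G" "y \<in> carrier G" and inf: "\<And>n::nat. x [^] n = \<one> \<Longrightarrow> n = 0"
    and "commens x y"
  shows "commens y x"
proof -
  obtain n m g z where g: "0 < n" "g \<in> carrier G" "z = y \<or> z = inv y"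
    and eq: "x [^] (n::nat) \<otimes> g = g \<otimes> z [^] (m::nat)"
    using assms(4) unfolding commens_def by blast
  have "m \<noteq> 0"
  proof
    assume "m = 0"
    then have "x [^] n \<otimes> g = \<one> \<otimes> g" using eq g by simp
    then have "x [^] n = \<one>" using x g by (subst (asm) right_cancel) auto
    then show False using inf g by blast
  qed
  have z: "z \<in> carrier G" using g x by auto
  have *: "z [^] m \<otimes> inv g = inv g \<otimes> x [^] n"
  proof -
    have "inv g \<otimes> x [^] n = inv g \<otimes> (x [^] n \<otimes> g) \<otimes> inv g"
      using x g by (simp add: m_assoc)
    also have "\<dots> = z [^] m \<otimes> inv g"
      using z g by (simp only: eq) (simp add: m_assoc[symmetric])
    finally show ?thesis by simp
  qed
  from g(3) show ?thesis
  proof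
    assume "z = y"
    then show ?thesis using * \<open>m \<noteq> 0\<close> g unfolding commens_def
      by (intro exI[of _ m] exI[of _ n] exI[of _ "inv g"] exI[of _ x]) auto
  next
    assume zy: "z = inv y"
    have "inv (z [^] m \<otimes> inv g) = inv (inv g \<otimes> x [^] n)" by (simp only: *)
    then have "g \<otimes> y [^] m = inv x [^] n \<otimes> g"
      using x g by (simp add: inv_mult_group zy nat_pow_inv)
    then have "inv g \<otimes> (g \<otimes> y [^] m) \<otimes> inv g = inv g \<otimes> (inv x [^] n \<otimes> g) \<otimes> inv g" by simp
    moreover have "inv g \<otimes> (g \<otimes> y [^] m) \<otimes> inv g = y [^] m \<otimes> inv g"
      using x g by (simp add: m_assoc[symmetric])
    moreover have "inv g \<otimes> (inv x [^] n \<otimes> g) \<otimes> inv g = inv g \<otimes> inv x [^] n"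
      using x g by (simp add: m_assoc)
    ultimately have "y [^] m \<otimes> inv g = inv g \<otimes> inv x [^] n" by (simp only:)
    then show ?thesis using \<open>m \<noteq> 0\<close> g unfolding commens_def
      by (intro exI[of _ m] exI[of _ n] exI[of _ "inv g"] exI[of _ "inv x"]) auto
  qed
qed

end

context ping_pong
begin

lemma L_commens_sym: "x \<in> L \<Longrightarrow> y \<in> carrier G \<Longrightarrow> commens x y \<Longrightarrow> commens y x"
  using commens_sym[of x y] L_closed L_pow_inj[of x _ 0] by auto

text \<open>The translate by \<open>g\<close> of the axis of \<open>z\<close> runs from the
  repelling to the attracting end of \<open>A k\<close>. It therefore crosses \<open>K\<close>, at
  one of finitely many translates of \<open>T\<close>, and far out it has points in
  \<open>A k <# P\<close>. These sets are disjoint, so the translate determines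
  \<open>k\<close>.\<close>

lemma finite_conj_powers:
  fixes A :: "nat \<Rightarrow> 'a"
  assumes A: "\<And>k. A k \<in> L" and disj: "\<And>k l. k \<noteq> l \<Longrightarrow> (A k <# P) \<inter> (A l <# P) = {}"
    and z: "z \<in> carrier G"
  shows "finite {k. \<exists>n m g. 0 < (n::nat) \<and> g \<in> carrier G \<and> A k [^] n \<otimes> g = g \<otimes> z [^] (m::nat)}"
    (is "finite ?S")
proof -
  obtain T where T: "finite T" "linked T" "\<one> \<in> T" "z \<in> T" "T \<subseteq> carrier G"
    using linked_finite_superset[OF linked_carrier, of "{\<one>, z}"] z by auto
  let ?F = "{h \<in> carrier G. (h <# T) \<inter> K \<noteq> {}}"
  have F: "finite ?F" by (rule finite_meeting(1)[OF T(1) finite_K T(5) K_closed])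
  have "\<exists>h. h \<in> ?F \<and> (\<exists>m N0. 0 < (m::nat) \<and> (\<forall>N\<ge>N0::nat. h \<otimes> z [^] (m * N) \<in> A k <# P))"
    if "k \<in> ?S" for k
  proof -
    let ?a = "A k"
    have a: "?a \<in> L" "?a \<in> carrier G" using A L_closed by auto
    obtain n m g where g: "0 < n" "g \<in> carrier G" and eq: "?a [^] (n::nat) \<otimes> g = g \<otimes> z [^] (m::nat)"
      using \<open>k \<in> ?S\<close> by (elim CollectE exE conjE) (rule that)
    have it: "?a [^] (n * N) \<otimes> g = g \<otimes> z [^] (m * N)" for N
      by (rule pow_conj_iterate[OF a(2) g(2) z eq])
    have "m \<noteq> 0"
    proof
      assume "m = 0"
      then have "?a [^] n \<otimes> g = \<one> \<otimes> g" using eq g by simp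
      then have "?a [^] n = \<one>" using a g by (subst (asm) right_cancel) auto
      then show False using L_pow_inj[OF a(1), of n 0] g by simp
    qed
    \<comment> \<open>Moving the axis back by a power of \<open>A k\<close> places its starting
      point in \<open>Q\<close>.\<close>
    obtain i :: nat where i: "inv (?a [^] i) \<otimes> g \<in> Q"
      using L_pow_eventually_Q[OF a(1) g(2)] by blast
    let ?q = "inv (?a [^] i) \<otimes> g"
    have q: "?q \<in> carrier G" using a g by simp
    have shift: "?q \<otimes> z [^] (m * N) = ?a [^] (n * N - i) \<otimes> g" if "i \<le> N" for N
    proof -
      have "i \<le> n * N" using that g(1) by (metis le_trans mult_le_mono1 nat_mult_1 Suc_leI One_nat_def)
      have "?q \<otimes> z [^] (m * N) = inv (?a [^] i) \<otimes> (?a [^] (n * N) \<otimes> g)"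
        using a g z by (simp add: it m_assoc)
      also have "?a [^] (n * N) = ?a [^] i \<otimes> ?a [^] (n * N - i)"
        using a \<open>i \<le> n * N\<close> by (simp add: nat_pow_mult)
      also have "inv (?a [^] i) \<otimes> (?a [^] i \<otimes> ?a [^] (n * N - i) \<otimes> g) = ?a [^] (n * N - i) \<otimes> g"
        using a g by (simp add: m_assoc[symmetric])
      finally show ?thesis .
    qed
    have n_ge: "N - i \<le> n * N - i" for N using g(1) by (intro diff_le_mono) simp
    obtain M where M: "\<And>N. M \<le> N \<Longrightarrow> ?a [^] (N::nat) \<otimes> g \<in> P"
      using L_pow_eventually_P[OF a(1) g(2)] by blast
    let ?N = "Suc (M + i)"
    have "?q \<otimes> z [^] (m * ?N) \<in> P"
      using M[of "n * ?N - i"] n_ge[of ?N] by (subst shift) auto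
    moreover have "?q \<otimes> z [^] (m * ?N) \<in> ?q <# tube T z (m * ?N)"
      using \<open>m \<noteq> 0\<close> by (intro l_coset_mem pow_in_tube T(2-4)) auto
    moreover have "?q \<in> ?q <# tube T z (m * ?N)"
      using l_coset_mem[OF pow_in_tube[OF T(2-4), of 0 "m * ?N"], of ?q] q \<open>m \<noteq> 0\<close> by simp
    moreover have "linked (?q <# tube T z (m * ?N))"
      by (intro linked_translate linked_tube T q)
    moreover have P1: "\<one> <# P = P" "\<one> <# Q = Q" "\<one> <# K = K"
      using lcos_mult_one P_closed Q_closed K_closed by auto
    ultimately have "K \<inter> (?q <# tube T z (m * ?N)) \<noteq> {}"
      using crossing[of \<one> ?q "?q \<otimes> z [^] (m * ?N)" "?q <# tube T z (m * ?N)"] i unfolding P1 by simp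
    then obtain j where j: "K \<inter> ((?q \<otimes> z [^] (j::nat)) <# T) \<noteq> {}"
      unfolding l_coset_tube[OF q z T(5)] Int_UN_nonempty_iff by (rule bexE) (rule that)
    let ?h = "?q \<otimes> z [^] (j::nat)"
    have h: "?h \<in> ?F" using j q z by (simp add: Int_commute)
    \<comment> \<open>One factor \<open>A k\<close> will be split off, so it suffices that the
      remaining power reaches \<open>P\<close>.\<close>
    obtain M' where M': "\<And>N. M' \<le> N \<Longrightarrow> ?a [^] (N::nat) \<otimes> (g \<otimes> z [^] j) \<in> P"
      using L_pow_eventually_P[OF a(1), of "g \<otimes> z [^] j"] g z by auto
    have "?h \<otimes> z [^] (m * N) \<in> ?a <# P" if N: "Suc (M' + i) \<le> N" for N
    proof -
      have "?h \<otimes> z [^] (m * N) = ?q \<otimes> z [^] (m * N) \<otimes> z [^] j"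
        using q z by (simp add: m_assoc nat_pow_mult add.commute)
      also have "\<dots> = ?a [^] (n * N - i) \<otimes> (g \<otimes> z [^] j)"
        using N a g z by (subst shift) (auto simp: m_assoc)
      also have "n * N - i = Suc (n * N - i - 1)" using N n_ge[of N] by simp
      also have "?a [^] Suc (n * N - i - 1) = ?a \<otimes> ?a [^] (n * N - i - 1)"
        by (rule nat_pow_Suc2[OF a(2)])
      also have "?a \<otimes> ?a [^] (n * N - i - 1) \<otimes> (g \<otimes> z [^] j)
          = ?a \<otimes> (?a [^] (n * N - i - 1) \<otimes> (g \<otimes> z [^] j))"
        using a g z by (simp add: m_assoc)
      also have "\<dots> \<in> ?a <# P"
        using N n_ge[of N] by (intro l_coset_mem M') simp
      finally show ?thesis .
    qed
    then show ?thesis using h \<open>m \<noteq> 0\<close> by blast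
  qed
  then have "\<forall>k\<in>?S. \<exists>h. h \<in> ?F \<and>
    (\<exists>m N0. 0 < (m::nat) \<and> (\<forall>N\<ge>N0::nat. h \<otimes> z [^] (m * N) \<in> A k <# P))" ..
  from bchoice[OF this] obtain h where h: "\<forall>k\<in>?S. h k \<in> ?F \<and>
    (\<exists>m N0. 0 < (m::nat) \<and> (\<forall>N\<ge>N0::nat. h k \<otimes> z [^] (m * N) \<in> A k <# P))" by (rule exE)
  have "inj_on h ?S"
  proof (rule inj_onI, rule ccontr)
    fix k l assume kl: "k \<in> ?S" "l \<in> ?S" "h k = h l" "k \<noteq> l"
    obtain m N0 where m: "0 < (m::nat)" "\<forall>N\<ge>N0::nat. h k \<otimes> z [^] (m * N) \<in> A k <# P"
      using bspec[OF h kl(1)] by (elim conjE exE) (rule that)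
    obtain m' N0' where m': "0 < (m'::nat)" "\<forall>N\<ge>N0'::nat. h l \<otimes> z [^] (m' * N) \<in> A l <# P"
      using bspec[OF h kl(2)] by (elim conjE exE) (rule that)
    \<comment> \<open>An exponent divisible by both \<open>m\<close> and \<open>m'\<close> brings
      one point into both disjoint sets.\<close>
    let ?M = "N0 + N0'"
    have le: "N0 \<le> m' * ?M" "N0' \<le> m * ?M"
      using m(1) m'(1) by (simp_all add: trans_le_add1 add_mult_distrib2 trans_le_add2)
    have "h k \<otimes> z [^] (m * (m' * ?M)) \<in> A k <# P" using m(2) le(1) by simp
    moreover have "h k \<otimes> z [^] (m * (m' * ?M)) \<in> A l <# P"
      using m'(2)[rule_format, OF le(2)] by (simp only: kl(3) mult.left_commute)
    ultimately show False using disj[OF kl(4)] by blast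
  qed
  moreover have "h ` ?S \<subseteq> ?F"
  proof (rule image_subsetI)
    fix k assume "k \<in> ?S"
    from bspec[OF h this] show "h k \<in> ?F" by (rule conjunct1)
  qed
  ultimately show ?thesis by (rule inj_on_finite[OF _ _ F])
qed

lemma finite_commens:
  fixes A :: "nat \<Rightarrow> 'a"
  assumes A: "\<And>k. A k \<in> L" and disj: "\<And>k l. k \<noteq> l \<Longrightarrow> (A k <# P) \<inter> (A l <# P) = {}"
    and y: "y \<in> carrier G"
  shows "finite {k. commens (A k) y}"
proof (rule finite_subset)
  let ?S = "\<lambda>z. {k. \<exists>n m g. 0 < (n::nat) \<and> g \<in> carrier G \<and> A k [^] n \<otimes> g = g \<otimes> z [^] (m::nat)}"
  show "finite (?S y \<union> ?S (inv y))"
    using finite_conj_powers[OF A disj y] finite_conj_powers[OF A disj inv_closed[OF y]] by simp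
  show "{k. commens (A k) y} \<subseteq> ?S y \<union> ?S (inv y)"
    unfolding commens_def by blast
qed

definition width :: "'a \<Rightarrow> nat" where
  "width y = card K * card (bridge y)"

text \<open>Each cut that meets the segment yields an element
  \<open>inv (h \<otimes> x [^] i) \<otimes> (g \<otimes> y [^] j)\<close> of a set with at most
  \<open>width y\<close> members. Equal elements for two different cuts would make \<open>x\<close>
  and \<open>y\<close> commensurable. The bound is independent of the length
  \<open>n\<close>.\<close>

lemma overlap:
  assumes x: "x \<in> L" and y: "y \<in> L" and h: "h \<in> carrier G" and g: "g \<in> carrier G"
    and nc: "\<not> commens x y"
    and I: "\<And>i. i \<in> I \<Longrightarrow> (h \<otimes> x [^] (i::nat) <# K) \<inter> (g <# seg y n) \<noteq> {}"
  shows "finite I" "card I \<le> width y"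
proof -
  have xy: "x \<in> carrier G" "y \<in> carrier G" using x y L_closed by auto
  let ?F = "{k \<in> carrier G. (k <# bridge y) \<inter> K \<noteq> {}}"
  have F: "finite ?F" "card ?F \<le> card (bridge y) * card K"
    using finite_meeting[OF bridge(1)[OF y] finite_K bridge(6)[OF y] K_closed] by auto
  have "\<exists>j. inv (h \<otimes> x [^] i) \<otimes> (g \<otimes> y [^] (j::nat)) \<in> ?F" if "i \<in> I" for i
  proof -
    have "(h \<otimes> x [^] i <# K) \<inter> (\<Union>j\<in>{0..<n}. g \<otimes> y [^] j <# bridge y) \<noteq> {}"
      using I[OF that] l_coset_seg[OF g y] by simp
    then obtain j where "(h \<otimes> x [^] i <# K) \<inter> (g \<otimes> y [^] (j::nat) <# bridge y) \<noteq> {}"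
      unfolding Int_UN_nonempty_iff by (rule bexE)
    then obtain k t where kt: "k \<in> K" "t \<in> bridge y" "h \<otimes> x [^] i \<otimes> k = g \<otimes> y [^] j \<otimes> t"
      unfolding l_coset_def by blast
    have c: "k \<in> carrier G" "t \<in> carrier G" using kt K_closed bridge(6)[OF y] by auto
    have "inv (h \<otimes> x [^] i) \<otimes> (g \<otimes> y [^] j) \<otimes> t = inv (h \<otimes> x [^] i) \<otimes> (h \<otimes> x [^] i \<otimes> k)"
      using c h g xy by (simp only: kt(3)) (simp add: m_assoc)
    also have "\<dots> = k" using c h xy m_assoc[of "inv (h \<otimes> x [^] i)" "h \<otimes> x [^] i" k] by simp
    finally have eq: "inv (h \<otimes> x [^] i) \<otimes> (g \<otimes> y [^] j) \<otimes> t = k" .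
    have "k \<in> (inv (h \<otimes> x [^] i) \<otimes> (g \<otimes> y [^] j)) <# bridge y"
      by (subst eq[symmetric]) (rule l_coset_mem[OF kt(2)])
    then show ?thesis using kt(1) h g xy by auto
  qed
  then have "\<forall>i\<in>I. \<exists>j. inv (h \<otimes> x [^] i) \<otimes> (g \<otimes> y [^] (j::nat)) \<in> ?F" ..
  from bchoice[OF this] obtain j
    where j': "\<forall>i\<in>I. inv (h \<otimes> x [^] i) \<otimes> (g \<otimes> y [^] (j i::nat)) \<in> ?F" by (rule exE)
  have j: "inv (h \<otimes> x [^] i) \<otimes> (g \<otimes> y [^] j i) \<in> ?F" if "i \<in> I" for i
    using j' that by (rule bspec)
  let ?f = "\<lambda>i. inv (h \<otimes> x [^] i) \<otimes> (g \<otimes> y [^] j i)"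
  \<comment> \<open>Equality of the two values is a relation as in \<open>commensI\<close>, with
    \<open>inv h \<otimes> g\<close> as conjugator.\<close>
  have inj_less: False if ii: "i < i'" "?f i = ?f i'" for i i'
  proof -
    have c: "?f i \<in> carrier G" using h g xy by simp
    have a: "inv h \<otimes> g \<otimes> y [^] j i = x [^] i \<otimes> ?f i" for i
      using h g xy by (simp add: inv_mult_group m_assoc[symmetric])
    have "x [^] (i' - i) \<otimes> (inv h \<otimes> g \<otimes> y [^] j i) = x [^] (i' - i) \<otimes> (x [^] i \<otimes> ?f i)"
      by (simp only: a)
    also have "\<dots> = x [^] i' \<otimes> ?f i"
      using c xy(1) ii(1) by (simp add: m_assoc[symmetric] nat_pow_mult)
    also have "\<dots> = inv h \<otimes> g \<otimes> y [^] j i'" by (simp only: a ii(2))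
    finally have "commens x y"
      using ii(1) h g xy by (intro commensI[of x y "inv h \<otimes> g" "i' - i" "j i" "j i'"]) auto
    then show False using nc by blast
  qed
  have "inj_on ?f I"
  proof (rule inj_onI)
    fix i i' assume "?f i = ?f i'"
    then show "i = i'" using inj_less[of i i'] inj_less[of i' i] by (metis linorder_neqE_nat)
  qed
  moreover have sub: "?f ` I \<subseteq> ?F" using j by blast
  ultimately show "finite I" by (rule inj_on_finite[OF _ _ F(1)])
  have "card I \<le> card ?F" using \<open>inj_on ?f I\<close> sub F(1) by (rule card_inj_on_le)
  then show "card I \<le> width y" using F(2) by (simp add: width_def mult.commute)
qed

section \<open>Occurrences of a word between two points\<close>

lemma ahead_translate: "ahead e f \<Longrightarrow> g \<in> carrier G \<Longrightarrow> ahead (g \<otimes> e) (g \<otimes> f)"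
  by (erule aheadE) (simp add: m_assoc[symmetric] L_closed aheadI)

text \<open>The counterpart of the occurrences of the word \<open>u\<close> on the way from
  \<open>x\<close> to \<open>y\<close> in Brooks' counting functions: \<open>g\<close> marks the
  start of an occurrence, and overlapping ones all count.\<close>

definition cross :: "'a \<Rightarrow> 'a \<Rightarrow> 'a \<Rightarrow> 'a set" where
  "cross u x y = {g \<in> carrier G. x \<in> g <# Q \<and> y \<in> g \<otimes> u <# P}"

text \<open>\<open>x\<close> lies behind the first cut of the occurrence and \<open>y\<close> beyond
  the last; nesting transfers both to every cut in between.\<close>

lemma cross_mid:
  assumes "g \<in> cross u x y" "f = \<one> \<or> ahead \<one> f" "f = u \<or> ahead f u"
  shows "x \<in> g \<otimes> f <# Q" "y \<in> g \<otimes> f <# P"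
proof -
  have g: "g \<in> carrier G" "x \<in> g <# Q" "y \<in> g \<otimes> u <# P" using assms by (auto simp: cross_def)
  show "x \<in> g \<otimes> f <# Q"
    using assms(2) g ahead_subset(4)[OF ahead_translate[of \<one> f g]] by auto
  show "y \<in> g \<otimes> f <# P"
    using assms(3) g ahead_subset(2)[OF ahead_translate[of f u g]] by auto
qed

lemma cross_meets:
  assumes "g \<in> cross u x y" "f = \<one> \<or> ahead \<one> f" "f = u \<or> ahead f u" "linked T" "x \<in> T" "y \<in> T"
  shows "(g \<otimes> f <# K) \<inter> T \<noteq> {}"
proof (rule crossing)
  show "g \<otimes> f \<in> carrier G" using assms(1,2) ahead_carrier by (auto simp: cross_def)
  show "x \<in> g \<otimes> f <# Q" "y \<in> g \<otimes> f <# P" using cross_mid[OF assms(1-3)] .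
qed (use assms in simp_all)

lemma ahead_one: "x \<in> L \<Longrightarrow> ahead \<one> x"
  using aheadI[OF one_closed] L_closed by fastforce

lemma cross_same: "u \<in> L \<Longrightarrow> cross u x x = {}"
proof (rule ccontr)
  assume u: "u \<in> L" and "cross u x x \<noteq> {}"
  then obtain g where g: "g \<in> cross u x x" by blast
  then have "x \<in> g \<otimes> \<one> <# Q" "x \<in> g \<otimes> \<one> <# P" "g \<in> carrier G"
    using cross_mid[OF g, of \<one>] ahead_one[OF u] by (auto simp: cross_def)
  then have "x \<in> g <# (P \<inter> Q)" using P_closed Q_closed by (simp add: l_coset_Int)
  then show False by (simp add: P_Int_Q l_coset_def)
qed

lemma cross_finite:
  assumes "u \<in> L" "linked T" "finite T" "x \<in> T" "y \<in> T"
  shows "finite (cross u x y)" "card (cross u x y) \<le> card K * card T"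
proof -
  have sub: "cross u x y \<subseteq> {g \<in> carrier G. (g <# K) \<inter> T \<noteq> {}}"
  proof
    fix g assume g: "g \<in> cross u x y"
    then have "(g \<otimes> \<one> <# K) \<inter> T \<noteq> {}"
      using cross_meets[OF g _ _ assms(2,4,5), of \<one>] ahead_one[OF assms(1)] by simp
    then show "g \<in> {g \<in> carrier G. (g <# K) \<inter> T \<noteq> {}}" using g by (simp add: cross_def)
  qed
  have "T \<subseteq> carrier G" using assms(2) by (simp add: linked_def)
  note fin = finite_meeting[OF finite_K assms(3) K_closed this]
  show "finite (cross u x y)" by (rule finite_subset[OF sub fin(1)])
  show "card (cross u x y) \<le> card K * card T"
    using card_mono[OF fin(1) sub] fin(2) by linarith
qed

text \<open>An occurrence of \<open>u\<close> along the axis of \<open>v\<close> would make the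
  \<open>p - 1\<close> cuts provided by \<open>mid\<close> meet a segment of this axis, more than
  \<open>overlap\<close> allows.\<close>

lemma cross_pow_empty:
  assumes v: "v \<in> L" and x: "x \<in> L" and h: "h \<in> carrier G" and nc: "\<not> commens x v"
    and mid: "\<And>i. 0 < i \<Longrightarrow> i < p \<Longrightarrow> ahead \<one> (h \<otimes> x [^] (i::nat)) \<and> ahead (h \<otimes> x [^] i) u"
    and p: "width v < p - 1" and u: "u \<in> L"
  shows "cross u \<one> (v [^] (k::nat)) = {}" "cross u (v [^] k) \<one> = {}"
proof -
  have main: "cross u a b = {}" if ab: "a \<in> seg v k" "b \<in> seg v k" for a b
  proof (rule ccontr)
    assume "cross u a b \<noteq> {}"
    then obtain g where g: "g \<in> cross u a b" by blast
    then have gc: "g \<in> carrier G" by (simp add: cross_def)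
    have "(g \<otimes> h \<otimes> x [^] i <# K) \<inter> (\<one> <# seg v k) \<noteq> {}" if "i \<in> {0<..<p}" for i
      using cross_meets[OF g _ _ linked_seg[OF v] ab, of "h \<otimes> x [^] i"] mid[of i] that
        h x gc L_closed by (simp add: m_assoc lcos_mult_one seg_closed[OF v])
    then have "card {0<..<p} \<le> width v"
      using overlap(2)[OF x v _ one_closed nc, of "g \<otimes> h" "{0<..<p}" k] gc h by simp
    then show False using p by simp
  qed
  have "\<one> \<in> seg v k \<and> v [^] k \<in> seg v k" if "0 < k"
    using pow_in_tube[OF bridge(2,7,8)[OF v], of 0 k] pow_in_tube[OF bridge(2,7,8)[OF v], of k k] that
    by (simp add: seg_def)
  then show "cross u \<one> (v [^] k) = {}" "cross u (v [^] k) \<one> = {}"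
    using main cross_same[OF u, of \<one>] by (cases "k = 0"; simp)+
qed

lemma cross_pow_card:
  assumes "u \<in> L" "c \<in> L" "finite (cross u \<one> ((u \<otimes> c) [^] (k::nat)))"
  shows "k - 1 \<le> card (cross u \<one> ((u \<otimes> c) [^] k))"
proof -
  let ?w = "u \<otimes> c"
  have w: "?w \<in> L" "?w \<in> carrier G" "u \<in> carrier G" "c \<in> carrier G" using assms L_mult L_closed by auto
  \<comment> \<open>The value \<open>i = 0\<close> is left out because \<open>\<one>\<close> lies in
    \<open>K\<close> and not in \<open>Q\<close>; hence the bound \<open>k - 1\<close>.\<close>
  have "?w [^] i \<in> cross u \<one> (?w [^] k)" if i: "i \<in> {0<..<k}" for i
  proof -
    have "\<one> \<in> ?w [^] i <# Q" using L_K'[OF L_pow[OF w(1)]] i one_K by auto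
    moreover have "?w [^] k \<in> ?w [^] i \<otimes> u <# P"
    proof -
      have k: "?w [^] k = ?w [^] i \<otimes> u \<otimes> (c \<otimes> ?w [^] (k - Suc i))"
      proof -
        have "?w [^] k = ?w [^] (i + Suc (k - Suc i))" using i by simp
        also have "\<dots> = ?w [^] i \<otimes> ?w [^] Suc (k - Suc i)" using w by (simp only: nat_pow_mult)
        also have "?w [^] Suc (k - Suc i) = ?w \<otimes> ?w [^] (k - Suc i)"
          using w by (intro nat_pow_Suc2)
        finally show ?thesis using w by (simp add: m_assoc)
      qed
      have "c \<otimes> ?w [^] (k - Suc i) \<in> L"
        using assms w L_mult L_pow[OF w(1)] by (cases "k - Suc i = 0") auto
      then show ?thesis unfolding k by (intro l_coset_mem L_in_P)
    qed
    ultimately show ?thesis using w by (simp add: cross_def)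
  qed
  moreover have "inj_on (\<lambda>i. ?w [^] i) {0<..<k}" using L_pow_inj[OF w(1)] by (auto intro: inj_onI)
  ultimately have "card {0<..<k} \<le> card (cross u \<one> (?w [^] k))"
    using assms(3) by (intro card_inj_on_le[of "\<lambda>i. ?w [^] i"]) auto
  then show ?thesis by simp
qed

end

section \<open>Words without reversed crossings\<close>

text \<open>An infinite word with syllables \<open>lam r [^] p\<close>. Axes of letters with
  different residues modulo 3 share at most \<open>c\<close> cuts, and \<open>p\<close> is so large
  that more than \<open>c\<close> cuts of a run remain after \<open>2 * c\<close> of them are set
  aside.\<close>

locale runs = ping_pong +
  fixes lam :: "nat \<Rightarrow> 'a" and c p :: nat
  assumes lam_L: "lam r \<in> L"
    and lam_not_commens: "r mod 3 \<noteq> s mod 3 \<Longrightarrow> \<not> commens (lam r) (lam s)"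
    and width_lam: "width (lam r) \<le> c"
    and p_ge: "3 * c + 3 \<le> p"
begin

text \<open>Prefixes of the word; \<open>run r\<close> leads from one prefix to the next along the
  axis of \<open>lam r\<close>.\<close>

primrec pos :: "nat \<Rightarrow> 'a" where
  "pos 0 = \<one>"
| "pos (Suc r) = pos r \<otimes> lam r [^] p"

definition run :: "nat \<Rightarrow> 'a set" where
  "run r = pos r <# seg (lam r) p"

lemma p_pos: "0 < p"
  using p_ge by simp

lemma lam_closed: "lam r \<in> carrier G"
  using lam_L L_closed by simp

lemma pos_closed: "pos r \<in> carrier G"
  by (induction r) (auto simp: lam_closed)

lemma ahead_pos_Suc: "ahead (pos r) (pos (Suc r))"
  using aheadI[OF pos_closed L_pow[OF lam_L p_pos]] by simp

lemma ahead_pos: "r < s \<Longrightarrow> ahead (pos r) (pos s)"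
proof (induction s)
  case (Suc s)
  then show ?case
    using ahead_pos_Suc[of s] ahead_trans[of "pos r" "pos s" "pos (Suc s)"] by (cases "r = s") auto
qed simp

lemma ahead_cut:
  assumes "0 < (j::nat)"
  shows "ahead (pos r) (pos r \<otimes> lam r [^] j)"
  using aheadI[OF pos_closed L_pow[OF lam_L assms]] .

lemma cut_ahead:
  assumes "j < p"
  shows "ahead (pos r \<otimes> lam r [^] j) (pos (Suc r))"
proof -
  have "pos (Suc r) = pos r \<otimes> lam r [^] j \<otimes> lam r [^] (p - j)"
    using assms by (simp add: m_assoc pos_closed lam_closed nat_pow_mult)
  then show ?thesis
    using aheadI[of "pos r \<otimes> lam r [^] j" "lam r [^] (p - j)"] assms L_pow[OF lam_L]
    by (simp add: pos_closed lam_closed)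
qed

lemma run_before:
  assumes "r < s" "0 < (j::nat)"
  shows "run r \<subseteq> pos s \<otimes> lam s [^] j <# Q"
  unfolding run_def
proof (rule seg_behind[OF _ lam_L pos_closed])
  have "ahead (pos (Suc r)) (pos s \<otimes> lam s [^] j)"
    using ahead_cut[OF assms(2), of s] ahead_trans[OF ahead_pos[of "Suc r" s]] assms(1)
    by (cases "Suc r = s") auto
  then show "ahead (pos r \<otimes> lam r [^] p) (pos s \<otimes> lam s [^] j)" by simp
qed

lemma run_after:
  assumes "s < t" "j < p"
  shows "run t \<subseteq> pos s \<otimes> lam s [^] j <# P"
  unfolding run_def
proof (rule seg_ahead[OF _ lam_L])
  show "ahead (pos s \<otimes> lam s [^] j) (pos t)"
    using cut_ahead[OF assms(2), of s] ahead_trans[OF _ ahead_pos[of "Suc s" t]] assms(1)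
    by (cases "Suc s = t") auto
qed

text \<open>An interior cut of \<open>run s\<close> has all earlier runs on its \<open>Q\<close>
  side and all later ones on its \<open>P\<close> side.\<close>

lemma cut_between:
  assumes "r < s" "s < t" "0 < j" "j < p" "linked T" "T \<inter> run r \<noteq> {}" "T \<inter> run t \<noteq> {}"
  shows "(pos s \<otimes> lam s [^] j <# K) \<inter> T \<noteq> {}"
proof -
  obtain x y where "x \<in> T" "x \<in> run r" "y \<in> T" "y \<in> run t" using assms(6,7) by blast
  then show ?thesis
    using run_before[OF assms(1,3)] run_after[OF assms(2,4)]
    by (intro crossing[OF _ _ _ assms(5), of _ x y]) (auto simp: pos_closed lam_closed)
qed

text \<open>The segment crosses all \<open>p - 1\<close> interior cuts of \<open>run s\<close>,
  which exceeds the overlap bound for different letters.\<close>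

lemma strictly_between_run:
  assumes "r < s" "s < t" "g \<in> carrier G"
    and "(g <# seg (lam q) n) \<inter> run r \<noteq> {}" "(g <# seg (lam q) n) \<inter> run t \<noteq> {}"
  shows "s mod 3 = q mod 3"
proof (rule ccontr)
  assume ne: "s mod 3 \<noteq> q mod 3"
  have "linked (g <# seg (lam q) n)" using assms(3) linked_seg[OF lam_L] by (intro linked_translate)
  then have "(pos s \<otimes> lam s [^] j <# K) \<inter> (g <# seg (lam q) n) \<noteq> {}" if "j \<in> {0<..<p}" for j
    using that cut_between[OF assms(1,2) _ _ _ assms(4,5)] by simp
  then have "card {0<..<p} \<le> width (lam q)"
    by (rule overlap(2)[OF lam_L lam_L pos_closed assms(3) lam_not_commens[OF ne]])
  then show False using width_lam[of q] p_ge by simp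
qed

lemma overlap_run:
  assumes "g \<in> carrier G" "q mod 3 \<noteq> r mod 3"
    and "\<And>i. i \<in> I \<Longrightarrow> (g \<otimes> lam q [^] (i::nat) <# K) \<inter> run r \<noteq> {}"
  shows "finite I" "card I \<le> c"
  using overlap[OF lam_L lam_L assms(1) pos_closed lam_not_commens[OF assms(2)], of I r p]
    assms(3) width_lam[of r] unfolding run_def by simp_all

text \<open>Runs met by \<open>2 * c + 1\<close> successive cuts of \<open>lam q\<close> have, apart from the first and the last
  of them, the same letter; the two exceptions absorb at most \<open>c\<close> cuts each.\<close>
lemma ex_cut_meeting_same_letter:
  assumes g: "g \<in> carrier G"
    and meets: "\<And>i. i \<le> 2 * c \<Longrightarrow> \<exists>r<n. (g \<otimes> lam q [^] i <# K) \<inter> run r \<noteq> {}"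
  shows "\<exists>i r. i \<le> 2 * c \<and> r < n \<and> r mod 3 = q mod 3 \<and> (g \<otimes> lam q [^] i <# K) \<inter> run r \<noteq> {}"
proof (rule ccontr)
  assume "\<not> ?thesis"
  then have none: "r mod 3 \<noteq> q mod 3"
    if "i \<le> 2 * c" "r < n" "(g \<otimes> lam q [^] i <# K) \<inter> run r \<noteq> {}" for i r
    using that by metis
  let ?M = "{r. r < n \<and> (\<exists>i\<le>2 * c. (g \<otimes> lam q [^] i <# K) \<inter> run r \<noteq> {})}"
  have fin: "finite ?M" by simp
  obtain r0 where "r0 < n" "(g \<otimes> lam q [^] (0::nat) <# K) \<inter> run r0 \<noteq> {}"
    using meets[of 0] by auto
  then have "r0 \<in> ?M" by (intro CollectI conjI exI[of _ 0]) auto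
  then have "?M \<noteq> {}" by (metis empty_iff)
  note mem = Min_in[OF fin this] Max_in[OF fin this]
  let ?T = "g <# seg (lam q) (2 * c + 1)"
  have T: "?T \<inter> run r \<noteq> {}" if rM: "r \<in> ?M" for r
  proof -
    obtain i where "i \<le> 2 * c" "(g \<otimes> lam q [^] i <# K) \<inter> run r \<noteq> {}" using rM by blast
    then show ?thesis using cut_in_seg'[OF g lam_L, of i "2 * c + 1" q] by auto
  qed
  let ?I = "\<lambda>r. {i. i \<le> 2 * c \<and> (g \<otimes> lam q [^] i <# K) \<inter> run r \<noteq> {}}"
  have small: "card (?I r) \<le> c" if "r \<in> ?M" for r
  proof (rule overlap_run(2)[OF g])
    show "q mod 3 \<noteq> r mod 3" using that none by fastforce
  qed simp
  have "{0..2 * c} \<subseteq> ?I (Min ?M) \<union> ?I (Max ?M)"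
  proof
    fix i assume i: "i \<in> {0..2 * c}"
    then obtain r where r: "r < n" "(g \<otimes> lam q [^] i <# K) \<inter> run r \<noteq> {}" using meets[of i] by auto
    then have rM: "r \<in> ?M" using i by auto
    have "\<not> (Min ?M < r \<and> r < Max ?M)"
      using strictly_between_run[OF _ _ g T[OF mem(1)] T[OF mem(2)], of r] none[of i r] r i by auto
    moreover have "Min ?M \<le> r" "r \<le> Max ?M" using Min_le[OF fin rM] Max_ge[OF fin rM] .
    ultimately have "r = Min ?M \<or> r = Max ?M" by linarith
    then show "i \<in> ?I (Min ?M) \<union> ?I (Max ?M)" using r i by auto
  qed
  then have "card {0..2 * c} \<le> card (?I (Min ?M) \<union> ?I (Max ?M))"
    by (intro card_mono) auto
  also have "\<dots> \<le> card (?I (Min ?M)) + card (?I (Max ?M))" by (rule card_Un_le)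
  also have "\<dots> \<le> c + c" using small[OF mem(1)] small[OF mem(2)] by (rule add_mono)
  finally show False by simp
qed

lemma pos_in_run: "pos i \<in> run i" "pos (Suc i) \<in> run i"
proof -
  note pit = pow_in_tube[OF bridge(2,7,8)[OF lam_L]]
  show "pos i \<in> run i" "pos (Suc i) \<in> run i"
    using l_coset_mem[OF pit[of 0 p i], of "pos i"] l_coset_mem[OF pit[of p p i], of "pos i"] p_pos
    by (simp_all add: run_def seg_def pos_closed)
qed

lemma linked_runs: "linked (\<Union>r\<in>{m..<n}. run r)"
proof (rule linked_UN_interval)
  show "linked (run i)" for i
    unfolding run_def by (intro linked_translate linked_seg lam_L pos_closed)
  show "run i \<inter> run (Suc i) \<noteq> {}" for i using pos_in_run(1)[of "Suc i"] pos_in_run(2)[of i] by blast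
qed

text \<open>Read backwards, \<open>pos 2\<close> would show a run of \<open>lam 1\<close> before a run of \<open>lam 0\<close>. Along the
  forward path either a full run of \<open>lam 2\<close> lies between them, or they are adjacent in the
  wrong order; both contradict the bounded overlap of different letters.\<close>
lemma no_reversed_crossing: "cross (pos 2) (pos n) \<one> = {}"
proof (rule ccontr)
  assume "cross (pos 2) (pos n) \<one> \<noteq> {}"
  then obtain g where g: "g \<in> cross (pos 2) (pos n) \<one>" by blast
  then have gc: "g \<in> carrier G" by (simp add: cross_def)
  define a b where "a = lam 0" and "b = lam 1"
  have ab: "a \<in> L" "b \<in> L" "a \<in> carrier G" "b \<in> carrier G"
    by (simp_all add: a_def b_def lam_L lam_closed)
  have pos1: "pos 1 = a [^] p" by (simp add: a_def lam_closed)
  have pos2: "pos 2 = a [^] p \<otimes> b [^] p" by (simp add: a_def b_def lam_closed numeral_2_eq_2)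
  have "pos 2 \<in> L"
    unfolding pos2 using L_mult[OF L_pow[OF ab(1) p_pos] L_pow[OF ab(2) p_pos]] .
  then have n: "0 < n" using g cross_same[of "pos 2" \<one>] by (cases n) auto
  have a_mid: "ahead \<one> (a [^] i)" if "0 < i" for i :: nat
    using ahead_one[OF L_pow[OF ab(1) that]] .
  have a_step: "ahead (a [^] i) (a [^] p)" if "i < p" for i
    using cut_ahead[OF that, of 0] ab by (simp add: a_def lam_closed)
  have a_end: "ahead (a [^] i) (pos 2)" if "i \<le> p" for i :: nat
  proof -
    have "ahead (a [^] p) (pos 2)" using ahead_pos[of 1 2] pos1 by simp
    then show ?thesis using that a_step[of i] ahead_trans[of "a [^] i" "a [^] p" "pos 2"] by (cases "i = p") auto
  qed
  have b_mid: "ahead \<one> (a [^] p \<otimes> b [^] j)" for j :: nat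
    using ahead_trans[OF a_mid[OF p_pos] aheadI[OF _ L_pow[OF ab(2)], of "a [^] p" j]] ab
      a_mid[OF p_pos] by (cases "j = 0") auto
  have b_end: "ahead (a [^] p \<otimes> b [^] j) (pos 2)" if "j < p" for j :: nat
    using cut_ahead[OF that, of 1] pos1 by (simp add: b_def numeral_2_eq_2)
  \<comment> \<open>Every cut of the occurrence separates \<open>pos n\<close> from
    \<open>\<one>\<close>, so it crosses the chain of runs joining these points.\<close>
  have path: "\<exists>r<n. (g \<otimes> f <# K) \<inter> run r \<noteq> {}" if f: "f = \<one> \<or> ahead \<one> f" "f = pos 2 \<or> ahead f (pos 2)" for f
  proof -
    have "\<one> \<in> (\<Union>r\<in>{0..<n}. run r)" using pos_in_run(1)[of 0] n by auto
    moreover have "pos n \<in> (\<Union>r\<in>{0..<n}. run r)"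
      using pos_in_run(2)[of "n - 1"] n by (intro UN_I[of "n - 1"]) auto
    ultimately have "(g \<otimes> f <# K) \<inter> (\<Union>r\<in>{0..<n}. run r) \<noteq> {}"
      using cross_meets[OF g f linked_runs] by blast
    then show ?thesis by auto
  qed
  \<comment> \<open>The \<open>a\<close> part of the occurrence yields a run \<open>m1\<close> with
    letter 0; the \<open>b\<close> part then yields a run \<open>m2\<close> with letter 1.\<close>
  have "\<exists>r<n. (g \<otimes> lam 0 [^] i <# K) \<inter> run r \<noteq> {}" if i: "i \<le> 2 * c" for i
    using path[of "a [^] i"] a_mid[of i] a_end[of i] i p_ge by (cases "i = 0") (auto simp: a_def)
  then obtain i m1 where im: "i \<le> 2 * c" "m1 < n" "m1 mod 3 = 0" "(g \<otimes> a [^] i <# K) \<inter> run m1 \<noteq> {}"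
    using ex_cut_meeting_same_letter[OF gc, of n 0] unfolding a_def mod_0 by metis
  have gap: "g \<otimes> a [^] p \<in> carrier G" using gc ab by simp
  have "\<exists>r<n. (g \<otimes> a [^] p \<otimes> lam 1 [^] j <# K) \<inter> run r \<noteq> {}" if j: "j \<le> 2 * c" for j
  proof -
    have "g \<otimes> a [^] p \<otimes> b [^] j = g \<otimes> (a [^] p \<otimes> b [^] j)" using gc ab by (simp add: m_assoc)
    then show ?thesis
      using path[of "a [^] p \<otimes> b [^] j"] b_mid[of j] b_end[of j] j p_ge by (auto simp: b_def)
  qed
  then obtain j m2 where jm: "j \<le> 2 * c" "m2 < n" "m2 mod 3 = 1"
    "(g \<otimes> a [^] p \<otimes> b [^] j <# K) \<inter> run m2 \<noteq> {}"
    using ex_cut_meeting_same_letter[OF gap, of n 1] unfolding b_def by auto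
  let ?A = "g <# seg a p" and ?B = "g \<otimes> a [^] p <# seg b p"
  have lA: "linked ?A" and lB: "linked ?B"
    using gc gap ab linked_seg by (simp_all add: linked_translate)
  have sA: "g \<otimes> a [^] i <# K \<subseteq> ?A" if "i \<le> p" for i using cut_in_seg'[OF gc ab(1) that p_pos] .
  have sB: "g \<otimes> a [^] p \<otimes> b [^] j <# K \<subseteq> ?B" if "j \<le> p" for j using cut_in_seg'[OF gap ab(2) that p_pos] .
  have meetA: "?A \<inter> run m1 \<noteq> {}" using sA[of i] im p_ge by auto
  have meetB: "?B \<inter> run m2 \<noteq> {}" using sB[of j] jm p_ge by auto
  have "m1 \<noteq> m2" using im jm by auto
  then consider "m2 < m1" | "m1 < m2" by linarith
  then show False
  proof cases
    case 1
    \<comment> \<open>The letters cycle as 0, 1, 2, so a run with letter 2 lies strictly between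
      \<open>run m2\<close> and \<open>run m1\<close>. The \<open>a\<close> and \<open>b\<close>
      parts share the point \<open>g \<otimes> a [^] p\<close>; together they cross the
      \<open>p - 1\<close> interior cuts of that run, but each meets at most \<open>c\<close> of
      them.\<close>
    have m: "Suc m2 mod 3 = 2" using jm(3) by (simp add: mod_Suc)
    have "Suc m2 \<noteq> m1" using m im(3) by auto
    then have lt: "m2 < Suc m2" "Suc m2 < m1" using 1 by auto
    have "a [^] p \<in> seg a p" using pow_in_tube[OF bridge(2,7,8)[OF ab(1)], of p p] p_pos by (simp add: seg_def)
    then have "g \<otimes> a [^] p \<in> ?A" by (rule l_coset_mem)
    moreover have "g \<otimes> a [^] p \<in> ?B"
      using l_coset_mem[OF pow_in_tube[OF bridge(2,7,8)[OF ab(2)], of 0 p], of "g \<otimes> a [^] p"] p_pos gap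
      by (simp add: seg_def)
    ultimately have l: "linked (?A \<union> ?B)" using linked_Un[OF lA lB] by blast
    let ?J = "\<lambda>X. {k. 0 < k \<and> k < p \<and> (pos (Suc m2) \<otimes> lam (Suc m2) [^] k <# K) \<inter> X \<noteq> {}}"
    have "{0<..<p} \<subseteq> ?J ?A \<union> ?J ?B"
    proof
      fix k assume k: "k \<in> {0<..<p}"
      have "(pos (Suc m2) \<otimes> lam (Suc m2) [^] k <# K) \<inter> (?A \<union> ?B) \<noteq> {}"
        using k meetA meetB by (intro cut_between[OF lt _ _ l]) auto
      then show "k \<in> ?J ?A \<union> ?J ?B" using k unfolding Int_Un_distrib by auto
    qed
    then have "card {0<..<p} \<le> card (?J ?A \<union> ?J ?B)" by (intro card_mono) auto
    also have "\<dots> \<le> card (?J ?A) + card (?J ?B)" by (rule card_Un_le)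
    also have "card (?J ?A) \<le> width a"
      using overlap(2)[OF lam_L ab(1) pos_closed gc, of "Suc m2" "?J ?A" "Suc m2" p]
        lam_not_commens[of "Suc m2" 0] m by (simp add: a_def)
    also have "card (?J ?B) \<le> width b"
      using overlap(2)[OF lam_L ab(2) pos_closed gap, of "Suc m2" "?J ?B" "Suc m2" p]
        lam_not_commens[of "Suc m2" 1] m by (simp add: b_def)
    finally show False using width_lam[of 0] width_lam[of 1] p_ge by (simp add: a_def b_def)
  next
    case 2
    let ?E = "\<Union>r\<in>{m2..<n}. run r"
    \<comment> \<open>This cut has a point of \<open>run m2\<close> beyond it and
      \<open>pos n\<close> behind it, so it meets some run from \<open>m2\<close> on. As the
      \<open>a\<close> part also meets \<open>run m1\<close>, that run can only be the next one,
      whose letter is 1; more than \<open>c\<close> cuts would meet it.\<close>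
    have "(g \<otimes> a [^] k <# K) \<inter> run (Suc m1) \<noteq> {}" if k: "k \<in> {2 * c<..<p}" for k
    proof -
      have kp: "0 < k" "k < p" using k by auto
      have "ahead (a [^] k) (a [^] p \<otimes> b [^] j)"
      proof (cases "j = 0")
        case True
        then show ?thesis using a_step[OF kp(2)] ab by simp
      next
        case False
        then have "ahead (a [^] p) (a [^] p \<otimes> b [^] j)" using aheadI[OF _ L_pow[OF ab(2)]] ab by simp
        then show ?thesis using ahead_trans[OF a_step[OF kp(2)]] by blast
      qed
      from ahead_translate[OF this gc]
      have "ahead (g \<otimes> a [^] k) (g \<otimes> a [^] p \<otimes> b [^] j)" using gc ab by (simp add: m_assoc)
      then have "g \<otimes> a [^] p \<otimes> b [^] j <# K \<subseteq> g \<otimes> a [^] k <# P" by (rule ahead_subset(1))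
      then obtain z where z: "z \<in> g \<otimes> a [^] k <# P" "z \<in> run m2" using jm(4) by blast
      have "pos n \<in> g \<otimes> a [^] k <# Q"
        using cross_mid(1)[OF g, of "a [^] k"] a_mid[OF kp(1)] a_end[of k] kp by simp
      moreover have "pos n \<in> ?E"
        using pos_in_run(2)[of "n - 1"] jm(2) by (intro UN_I[of "n - 1"]) auto
      moreover have "z \<in> ?E" using z jm(2) by auto
      ultimately have "(g \<otimes> a [^] k <# K) \<inter> ?E \<noteq> {}"
        using gc ab z(1) by (intro crossing[OF _ _ _ linked_runs, of _ "pos n" z]) auto
      then obtain r where r: "m2 \<le> r" "(g \<otimes> a [^] k <# K) \<inter> run r \<noteq> {}"
        unfolding Int_UN_nonempty_iff by (elim bexE) (rule that, simp_all)
      have rA: "?A \<inter> run r \<noteq> {}" using r(2) sA[of k] kp by auto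
      have "\<not> Suc m1 < r"
        using strictly_between_run[of m1 "Suc m1" r g 0 p] gc meetA rA im(3)
        by (auto simp: a_def mod_Suc)
      then have "r = Suc m1" using r(1) 2 by simp
      then show ?thesis using r(2) by simp
    qed
    then have "card {2 * c<..<p} \<le> c"
      using overlap_run(2)[OF gc, of 0 "Suc m1" "{2 * c<..<p}"] im(3)
      by (simp add: a_def mod_Suc)
    then show False using p_ge by simp
  qed
qed

end

section \<open>Counting quasimorphisms\<close>

context cayley_graph
begin

definition joined :: "'a set \<Rightarrow> 'a \<Rightarrow> 'a \<Rightarrow> bool" where
  "joined A x y \<longleftrightarrow> (\<exists>T. linked T \<and> T \<inter> A = {} \<and> x \<in> T \<and> y \<in> T)"

lemma joined_comp: "joined A x y \<Longrightarrow> comp A C \<Longrightarrow> x \<in> C \<longleftrightarrow> y \<in> C"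
  unfolding joined_def using comp_max[of A C] by blast

lemma comp_joined: "comp A C \<Longrightarrow> x \<in> C \<Longrightarrow> y \<in> C \<Longrightarrow> joined A x y"
  unfolding joined_def using comp_linked comp_disjoint by blast

lemma joined_mono: "joined A x y \<Longrightarrow> B \<subseteq> A \<Longrightarrow> joined B x y"
  unfolding joined_def by blast

text \<open>A point outside \<open>C\<close> lies in another component, which hangs on
  \<open>M\<close> and together with \<open>M\<close> misses \<open>M'\<close>. Both points are thus
  joined through \<open>M\<close>.\<close>

lemma joined_past:
  assumes "linked M" "M \<noteq> {}" "comp M C" "M' \<subseteq> C"
    and "x \<in> carrier G" "x \<notin> M" "x \<notin> C" "y \<in> carrier G" "y \<notin> M" "y \<notin> C"
  shows "joined M' x y"
proof -
  have *: "\<exists>T. linked T \<and> T \<inter> M' = {} \<and> M \<subseteq> T \<and> w \<in> T"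
    if w: "w \<in> carrier G" "w \<notin> M" "w \<notin> C" for w
  proof -
    obtain D where D: "comp M D" "w \<in> D" using comp_exists w(1,2) by blast
    have "D \<inter> C = {}" using comp_eq[OF D(1) assms(3)] D(2) w(3) by blast
    then have "(M \<union> D) \<inter> M' = {}" using comp_disjoint[OF assms(3)] assms(4) by blast
    then show ?thesis using comp_Un_linked[OF D(1) assms(1,2)] D(2) by blast
  qed
  obtain T where T: "linked T" "T \<inter> M' = {}" "M \<subseteq> T" "x \<in> T" using *[OF assms(5-7)] by blast
  obtain U where U: "linked U" "U \<inter> M' = {}" "M \<subseteq> U" "y \<in> U" using *[OF assms(8-10)] by blast
  have "linked (T \<union> U)" using linked_Un[OF T(1) U(1)] T(3) U(3) assms(2) by blast
  then show ?thesis unfolding joined_def using T U by (intro exI[of _ "T \<union> U"]) auto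
qed

text \<open>If \<open>M'\<close> lies in one component of the complement of \<open>M\<close>, then two of any three points
  separated by \<open>M\<close> lie outside that component and are joined through \<open>M\<close>.\<close>
lemma joined_one_of_two:
  assumes "linked M" "M \<noteq> {}" "linked M'" "M' \<noteq> {}" "M \<inter> M' = {}"
    and xyz: "x \<in> carrier G - M" "y \<in> carrier G - M" "z \<in> carrier G - M"
  shows "joined M x y \<or> joined M y z \<or> joined M z x \<or> joined M' x y \<or> joined M' y z \<or> joined M' z x"
proof -
  obtain q where q: "q \<in> M'" using assms(4) by blast
  then have "q \<in> carrier G" "q \<notin> M" using assms(3,5) by (auto simp: linked_def)
  then obtain C where C: "comp M C" "q \<in> C" using comp_exists by blast
  have MC: "M' \<subseteq> C" using comp_max[OF C(1) assms(3)] assms(5) q C(2) by blast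
  note past = joined_past[OF assms(1,2) C(1) MC]
  note inC = comp_joined[OF C(1)]
  show ?thesis
    using past[of x y] past[of y z] past[of z x] inC[of x y] inC[of y z] inC[of z x] xyz by blast
qed

end

section \<open>The counting quasimorphisms and their defect\<close>

context ping_pong
begin

definition sgn_cross :: "'a \<Rightarrow> 'a \<Rightarrow> 'a \<Rightarrow> 'a \<Rightarrow> real" where
  "sgn_cross u g x y = of_bool (g \<in> cross u x y) - of_bool (g \<in> cross u y x)"

definition net :: "'a \<Rightarrow> 'a \<Rightarrow> 'a \<Rightarrow> real" where
  "net u x y = real (card (cross u x y)) - real (card (cross u y x))"

definition qm :: "'a \<Rightarrow> 'a \<Rightarrow> real" where
  "qm u g = net u \<one> g"

text \<open>With \<open>N = card (bridge u)\<close>, at most \<open>3 * N\<close> translates of the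
  bridge contain one of three given points and at most \<open>N ^ 2\<close> meet a given translate;
  each contributes at most 3 in \<open>net_triangle\<close>.\<close>

definition defect :: "'a \<Rightarrow> real" where
  "defect u = 3 * (3 * real (card (bridge u)) + real (card (bridge u)) ^ 2)"

text \<open>The translated bridge contains both end cuts of the occurrence, so \<open>x\<close> and
  \<open>y\<close> lie on the same side of each. They are interchangeable and the three terms
  cancel.\<close>

lemma sgn_cross_triangle_joined:
  assumes u: "u \<in> L" and g: "g \<in> carrier G" and j: "joined (g <# bridge u) x y"
  shows "sgn_cross u g x y + sgn_cross u g y z + sgn_cross u g z x = 0"
proof -
  have uc: "u \<in> carrier G" using u L_closed by simp
  have "g \<otimes> u <# K = g <# (u <# K)" using g uc K_closed by (simp add: l_coset_mult)
  then have sub: "g <# K \<subseteq> g <# bridge u" "g \<otimes> u <# K \<subseteq> g <# bridge u"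
    using bridge(3,4)[OF u] by (auto intro: l_coset_mono[THEN subsetD])
  have 1: "x \<in> g <# Q \<longleftrightarrow> y \<in> g <# Q"
    by (rule joined_comp[OF joined_mono[OF j sub(1)] comp_translate[OF comp_Q g K_closed]])
  have 2: "x \<in> g \<otimes> u <# P \<longleftrightarrow> y \<in> g \<otimes> u <# P"
    using joined_comp[OF joined_mono[OF j sub(2)] comp_translate[OF comp_P _ K_closed]] g uc by simp
  have "g \<otimes> u <# P \<subseteq> g <# P" using ahead_subset(2)[OF aheadI[OF g u]] .
  moreover have "(g <# P) \<inter> (g <# Q) = {}"
    using g P_closed Q_closed P_Int_Q by (simp flip: l_coset_Int add: l_coset_empty_iff)
  ultimately have 3: "\<not> (x \<in> g <# Q \<and> x \<in> g \<otimes> u <# P)" by blast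
  show ?thesis unfolding sgn_cross_def cross_def using 1 2 3 by auto
qed

text \<open>A translate of the bridge contributes only if no two of the three points are joined in
  its complement. By \<open>joined_one_of_two\<close> any two such translates avoiding the points
  intersect, so all of them meet a fixed one.\<close>

lemma net_triangle:
  assumes u: "u \<in> L" and xyz: "x \<in> carrier G" "y \<in> carrier G" "z \<in> carrier G"
  shows "\<bar>net u x y + net u y z + net u z x\<bar> \<le> defect u"
proof -
  let ?N = "bridge u"
  define W where "W = {x, y, z}"
  have W: "W \<subseteq> carrier G" "finite W" using xyz by (auto simp: W_def)
  obtain T where T: "finite T" "linked T" "W \<subseteq> T"
    using linked_finite_superset[OF linked_carrier W(2) _ W(1)] by (auto simp: W_def)
  have fin: "finite (cross u a b)" if "a \<in> W" "b \<in> W" for a b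
    using cross_finite(1)[OF u T(2,1)] T(3) that by blast
  define \<Omega> where "\<Omega> = (\<Union>a\<in>W. \<Union>b\<in>W. cross u a b)"
  have f\<Omega>: "finite \<Omega>" unfolding \<Omega>_def using W fin by simp
  have \<Omega>c: "\<Omega> \<subseteq> carrier G" unfolding \<Omega>_def cross_def by blast
  have net: "net u a b = (\<Sum>g\<in>\<Omega>. sgn_cross u g a b)" if "a \<in> W" "b \<in> W" for a b
  proof -
    have "real (card (cross u a b)) = (\<Sum>g\<in>\<Omega>. of_bool (g \<in> cross u a b))" if "a \<in> W" "b \<in> W" for a b
    proof -
      have "cross u a b \<subseteq> \<Omega>" using that unfolding \<Omega>_def by blast
      then show ?thesis using f\<Omega> by (simp add: sum_of_bool_eq Int_absorb1 Collect_mem_eq)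
    qed
    then show ?thesis using that by (simp add: net_def sgn_cross_def sum_subtractf)
  qed
  let ?t = "\<lambda>g. sgn_cross u g x y + sgn_cross u g y z + sgn_cross u g z x"
  define B where "B = {g \<in> \<Omega>. ?t g \<noteq> 0}"
  have fB: "finite B" using f\<Omega> by (simp add: B_def)
  have "net u x y + net u y z + net u z x = (\<Sum>g\<in>\<Omega>. ?t g)"
    by (simp add: net W_def sum.distrib)
  also have "\<dots> = (\<Sum>g\<in>B. ?t g)"
    using f\<Omega> by (intro sum.mono_neutral_right) (auto simp: B_def)
  finally have "\<bar>net u x y + net u y z + net u z x\<bar> \<le> (\<Sum>g\<in>B. \<bar>?t g\<bar>)"
    by (simp add: sum_abs)
  also have "\<dots> \<le> (\<Sum>g\<in>B. 3)" by (intro sum_mono) (auto simp: sgn_cross_def)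
  also have "\<dots> = 3 * real (card B)" by simp
  also have "real (card B) \<le> 3 * real (card ?N) + real (card ?N) ^ 2"
  proof -
    let ?H = "\<lambda>w. {g \<in> carrier G. (g <# ?N) \<inter> {w} \<noteq> {}}"
    have H: "finite (?H w)" "card (?H w) \<le> card ?N" if "w \<in> carrier G" for w
      using finite_meeting[OF bridge(1)[OF u] _ bridge(6)[OF u], of "{w}"] that by auto
    define B' where "B' = B - (?H x \<union> ?H y \<union> ?H z)"
    have meet: "(g <# ?N) \<inter> (g' <# ?N) \<noteq> {}" if gg: "g \<in> B'" "g' \<in> B'" for g g'
    proof
      assume dis: "(g <# ?N) \<inter> (g' <# ?N) = {}"
      have c: "g \<in> carrier G" "g' \<in> carrier G" using gg \<Omega>c by (auto simp: B'_def B_def)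
      have ne: "h <# ?N \<noteq> {}" "linked (h <# ?N)" if "h \<in> carrier G" for h
        using bridge(2,7)[OF u] that by (auto simp: l_coset_empty_iff linked_translate)
      have nj: "\<not> joined (h <# ?N) x y" "\<not> joined (h <# ?N) y z" "\<not> joined (h <# ?N) z x"
        if "h \<in> B'" for h
      proof -
        have hc: "h \<in> carrier G" and nz: "?t h \<noteq> 0" using that \<Omega>c by (auto simp: B'_def B_def)
        note tri = sgn_cross_triangle_joined[OF u hc]
        show "\<not> joined (h <# ?N) x y" using tri[of x y z] nz by linarith
        show "\<not> joined (h <# ?N) y z" using tri[of y z x] nz by linarith
        show "\<not> joined (h <# ?N) z x" using tri[of z x y] nz by linarith
      qed
      have "w \<in> carrier G - (g <# ?N)" if "w \<in> W" for w
        using that gg(1) W(1) c(1) by (auto simp: B'_def W_def)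
      then have "x \<in> carrier G - (g <# ?N)" "y \<in> carrier G - (g <# ?N)" "z \<in> carrier G - (g <# ?N)"
        by (simp_all add: W_def)
      from joined_one_of_two[OF ne(2)[OF c(1)] ne(1)[OF c(1)] ne(2)[OF c(2)] ne(1)[OF c(2)] dis this]
      show False using nj[OF gg(1)] nj[OF gg(2)] by blast
    qed
    have "card B' \<le> card ?N * card ?N"
    proof (cases "B' = {}")
      case False
      then obtain g0 where g0: "g0 \<in> B'" by blast
      then have g0c: "g0 \<in> carrier G" using \<Omega>c by (auto simp: B'_def B_def)
      have sub: "B' \<subseteq> {g \<in> carrier G. (g <# ?N) \<inter> (g0 <# ?N) \<noteq> {}}"
        using meet[OF _ g0] \<Omega>c by (auto simp: B'_def B_def)
      note fm = finite_meeting[OF bridge(1)[OF u] finite_l_coset[OF bridge(1)[OF u]] bridge(6)[OF u]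
          l_coset_closed[OF g0c bridge(6)[OF u]]]
      have "card (g0 <# ?N) \<le> card ?N"
        using card_image_le[OF bridge(1)[OF u], of "\<lambda>n. g0 \<otimes> n"]
        by (simp add: l_coset_def UNION_singleton_eq_range)
      then have "card ?N * card (g0 <# ?N) \<le> card ?N * card ?N" by simp
      then show ?thesis using card_mono[OF fm(1) sub] fm(2) by linarith
    qed simp
    moreover have "card B \<le> card (?H x \<union> ?H y \<union> ?H z) + card B'"
    proof -
      have "B \<subseteq> (?H x \<union> ?H y \<union> ?H z) \<union> B'" by (auto simp: B'_def)
      moreover have "finite ((?H x \<union> ?H y \<union> ?H z) \<union> B')"
        using H xyz fB by (simp add: B'_def)
      ultimately show ?thesis using card_mono card_Un_le le_trans by meson
    qed
    moreover have "card (?H x \<union> ?H y \<union> ?H z) \<le> card ?N + card ?N + card ?N"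
      using card_Un_le[of "?H x \<union> ?H y" "?H z"] card_Un_le[of "?H x" "?H y"] H(2) xyz
      by (meson add_mono le_trans order_refl)
    ultimately have "card B \<le> 3 * card ?N + card ?N * card ?N" by linarith
    then have "real (card B) \<le> real (3 * card ?N + card ?N * card ?N)" by (rule of_nat_mono)
    then show ?thesis by (simp add: power2_eq_square)
  qed
  finally show ?thesis unfolding defect_def by simp
qed

lemma card_cross_translate:
  assumes "k \<in> carrier G" "x \<in> carrier G" "y \<in> carrier G" "u \<in> carrier G"
  shows "card (cross u (k \<otimes> x) (k \<otimes> y)) = card (cross u x y)"
proof -
  have mem: "k \<otimes> x \<in> k \<otimes> g <# A \<longleftrightarrow> x \<in> g <# A"
    if "k \<in> carrier G" "x \<in> carrier G" "g \<in> carrier G" "A \<subseteq> carrier G" for k x g A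
    using that by (simp add: l_coset_iff inv_mult_group m_assoc) (simp add: m_assoc[symmetric])
  have sub: "(\<lambda>g. k \<otimes> g) ` cross u x y \<subseteq> cross u (k \<otimes> x) (k \<otimes> y)"
    if "k \<in> carrier G" "x \<in> carrier G" "y \<in> carrier G" for k x y
    using that assms(4) P_closed Q_closed by (auto simp: cross_def mem m_assoc)
  have "(\<lambda>g. inv k \<otimes> g) ` cross u (k \<otimes> x) (k \<otimes> y) \<subseteq> cross u x y"
    using sub[of "inv k" "k \<otimes> x" "k \<otimes> y"] assms by (simp add: m_assoc[symmetric])
  then have "bij_betw (\<lambda>g. k \<otimes> g) (cross u x y) (cross u (k \<otimes> x) (k \<otimes> y))"
    using sub[OF assms(1-3)] assms
    by (intro bij_betw_byWitness[where f' = "\<lambda>g. inv k \<otimes> g"])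
      (auto simp: cross_def m_assoc[symmetric])
  then show ?thesis by (simp add: bij_betw_same_card)
qed

text \<open>By left invariance this is the signed count around the triangle with vertices
  \<open>\<one>\<close>, \<open>g\<close> and \<open>g \<otimes> h\<close>.\<close>

lemma qm_defect:
  assumes u: "u \<in> L" and g: "g \<in> carrier G" "h \<in> carrier G"
  shows "\<bar>qm u h - qm u (g \<otimes> h) + qm u g\<bar> \<le> defect u"
proof -
  have "net u g (g \<otimes> h) = net u \<one> h"
    using card_cross_translate[OF g(1) one_closed g(2) L_closed[OF u]]
      card_cross_translate[OF g(1) g(2) one_closed L_closed[OF u]] g by (simp add: net_def)
  moreover have "net u (g \<otimes> h) \<one> = - net u \<one> (g \<otimes> h)" by (simp add: net_def)
  ultimately have "qm u h - qm u (g \<otimes> h) + qm u g = net u \<one> g + net u g (g \<otimes> h) + net u (g \<otimes> h) \<one>"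
    by (simp add: qm_def)
  then show ?thesis using net_triangle[OF u one_closed g(1), of "g \<otimes> h"] g by simp
qed

text \<open>The bound counts translates of \<open>K\<close> meeting a set \<open>T\<close> that
  depends on \<open>g\<close> alone. Uniformity in \<open>u\<close> later makes a series of such
  functions converge.\<close>

lemma qm_bounded:
  assumes "g \<in> carrier G"
  obtains C where "\<And>u. u \<in> L \<Longrightarrow> \<bar>qm u g\<bar> \<le> C"
proof -
  obtain T where T: "finite T" "linked T" "{\<one>, g} \<subseteq> T"
    using linked_finite_superset[OF linked_carrier, of "{\<one>, g}"] assms by auto
  have "\<bar>qm u g\<bar> \<le> real (card K * card T)" if u: "u \<in> L" for u
  proof -
    have "card (cross u \<one> g) \<le> card K * card T" "card (cross u g \<one>) \<le> card K * card T"
      using cross_finite(2)[OF u T(2,1)] T(3) by auto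
    then have "real (card (cross u \<one> g)) \<le> real (card K * card T)"
      "real (card (cross u g \<one>)) \<le> real (card K * card T)" by (simp_all only: of_nat_mono)
    then show ?thesis unfolding qm_def net_def by (simp add: abs_le_iff)
  qed
  then show thesis by (rule that)
qed

lemma defect_ge_one: "u \<in> L \<Longrightarrow> 1 \<le> defect u"
proof -
  assume u: "u \<in> L"
  then have "card (bridge u) \<noteq> 0" using bridge(1,7)[OF u] by auto
  then have "1 \<le> real (card (bridge u))" by simp
  moreover have "0 \<le> real (card (bridge u)) ^ 2" by simp
  ultimately show ?thesis unfolding defect_def by argo
qed

lemma qm_pow_eq_0:
  assumes "cross u \<one> (v [^] (k::nat)) = {}" "cross u (v [^] k) \<one> = {}"
  shows "qm u (v [^] k) = 0"
  using assms by (simp add: qm_def net_def)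

lemma ex_not_commens:
  fixes A :: "nat \<Rightarrow> 'a"
  assumes A: "\<And>k. A k \<in> L" "\<And>k l. k \<noteq> l \<Longrightarrow> (A k <# P) \<inter> (A l <# P) = {}"
    and V: "finite V" "V \<subseteq> L"
  shows "\<exists>x\<in>L. \<forall>v\<in>V. \<not> commens x v \<and> \<not> commens v x"
proof -
  have "finite (\<Union>v\<in>V. {k. commens (A k) v})"
    using V L_closed by (intro finite_UN_I finite_commens A) auto
  then obtain k where k: "k \<notin> (\<Union>v\<in>V. {k. commens (A k) v})"
    using ex_new_if_finite infinite_UNIV_nat by blast
  have 1: "\<not> commens (A k) v" if "v \<in> V" for v using k that by blast
  have "\<not> commens v (A k)" if "v \<in> V" for v
    using L_commens_sym[of v "A k"] 1[OF that] that V(2) L_closed[OF A(1)[of k]] by blast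
  then show ?thesis using A(1)[of k] 1 by (intro bexI[of _ "A k"] ballI conjI)
qed

text \<open>\<open>u\<close> is \<open>a [^] p \<otimes> b [^] p\<close>. Its \<open>a\<close> part
  rules out occurrences along every \<open>v\<close> other than \<open>a\<close>, and its
  \<open>b\<close> part those along \<open>a\<close>. The third letter gives the cyclic order a
  direction, so that no occurrence is read backwards.\<close>

lemma ex_detecting_qm:
  fixes A :: "nat \<Rightarrow> 'a"
  assumes A: "\<And>k. A k \<in> L" "\<And>k l. k \<noteq> l \<Longrightarrow> (A k <# P) \<inter> (A l <# P) = {}"
    and V: "finite V" "V \<subseteq> L"
  obtains a b c u p where "a \<in> L" "b \<in> L" "c \<in> L" "u \<in> L" "0 < p"
    "\<And>v k. v \<in> V \<union> {a, b, c} \<Longrightarrow> qm u (v [^] (k::nat)) = 0"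
    "\<And>k. real k - 1 \<le> qm u ((a [^] (p::nat) \<otimes> b [^] p \<otimes> c [^] p) [^] k)"
proof -
  obtain a where a: "a \<in> L" "\<forall>v\<in>V. \<not> commens a v \<and> \<not> commens v a"
    using ex_not_commens[of A "V", OF A V] by (rule bexE)
  have aV: "finite (insert a V)" "insert a V \<subseteq> L" using V a by auto
  obtain b where b: "b \<in> L" "\<forall>v\<in>insert a V. \<not> commens b v \<and> \<not> commens v b"
    using ex_not_commens[of A "insert a V", OF A aV] by (rule bexE)
  have abL: "finite {a, b}" "{a, b} \<subseteq> L" using a b by auto
  obtain c where c: "c \<in> L" "\<forall>v\<in>{a, b}. \<not> commens c v \<and> \<not> commens v c"
    using ex_not_commens[of A "{a, b}", OF A abL] by (rule bexE)
  \<comment> \<open>The exponent is chosen after the letters, since it must exceed all their widths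
    and those of the elements of \<open>V\<close>.\<close>
  define M where "M = Max (width ` (V \<union> {a, b, c}))"
  have M: "width v \<le> M" if "v \<in> V \<union> {a, b, c}" for v
    unfolding M_def using that V by (intro Max_ge) auto
  define p where "p = 3 * M + 3"
  define lam where "lam = (\<lambda>r::nat. if r mod 3 = 0 then a else if r mod 3 = 1 then b else c)"
  interpret runs G S K P Q lam M p
  proof
    fix r s :: nat
    show "lam r \<in> L" using a b c by (simp add: lam_def)
    show "width (lam r) \<le> M" by (auto simp: lam_def M)
    show "3 * M + 3 \<le> p" by (simp add: p_def)
    assume rs: "r mod 3 \<noteq> s mod 3"
    have "r mod 3 = 0 \<or> r mod 3 = 1 \<or> r mod 3 = 2" "s mod 3 = 0 \<or> s mod 3 = 1 \<or> s mod 3 = 2"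
      by linarith+
    then show "\<not> commens (lam r) (lam s)" using rs a b c by (auto simp: lam_def)
  qed
  have cl: "a \<in> carrier G" "b \<in> carrier G" "c \<in> carrier G" using a b c L_closed by auto
  have lam: "lam 0 = a" "lam 1 = b" "lam (Suc 0) = b" by (simp_all add: lam_def)
  have pos1: "pos 1 = a [^] p" using cl lam by simp
  have pos2: "pos 2 = a [^] p \<otimes> b [^] p" using cl lam by (simp add: numeral_2_eq_2)
  let ?w = "a [^] p \<otimes> b [^] p \<otimes> c [^] p"
  have u: "pos 2 \<in> L" using L_mult[OF L_pow[OF a(1) p_pos] L_pow[OF b(1) p_pos]] pos2 by simp
  have w: "?w \<in> carrier G" using cl by simp
  \<comment> \<open>Powers of the word are prefixes of the periodic word, so
    \<open>no_reversed_crossing\<close> applies to them.\<close>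
  have pos3: "pos (3 * k) = ?w [^] k" for k
  proof (induction k)
    case (Suc k)
    have "3 * Suc k = Suc (Suc (Suc (3 * k)))" by simp
    moreover have "lam (3 * k) = a" "lam (Suc (3 * k)) = b" "lam (Suc (Suc (3 * k))) = c"
      by (simp_all add: lam_def mod_Suc)
    ultimately have "pos (3 * Suc k) = pos (3 * k) \<otimes> a [^] p \<otimes> b [^] p \<otimes> c [^] p"
      by (simp only: pos.simps)
    then show ?case using Suc cl by (simp add: m_assoc)
  qed simp
  have mid_a: "ahead \<one> (\<one> \<otimes> a [^] i) \<and> ahead (\<one> \<otimes> a [^] i) (pos 2)" if "0 < i" "i < p" for i :: nat
  proof
    show "ahead \<one> (\<one> \<otimes> a [^] i)" using ahead_one[OF L_pow[OF a(1) that(1)]] cl by simp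
    have "ahead (\<one> \<otimes> a [^] i) (pos 1)" using cut_ahead[OF that(2), of 0] lam by simp
    then show "ahead (\<one> \<otimes> a [^] i) (pos 2)" using ahead_trans ahead_pos[of 1 2] by simp
  qed
  have mid_b: "ahead \<one> (a [^] p \<otimes> b [^] i) \<and> ahead (a [^] p \<otimes> b [^] i) (pos 2)" if "0 < i" "i < p" for i :: nat
  proof
    have "ahead \<one> (a [^] p)" using ahead_one[OF L_pow[OF a(1) p_pos]] .
    then show "ahead \<one> (a [^] p \<otimes> b [^] i)"
      using ahead_trans aheadI[OF _ L_pow[OF b(1) that(1)], of "a [^] p"] cl by simp
    show "ahead (a [^] p \<otimes> b [^] i) (pos 2)"
      using cut_ahead[OF that(2), of 1] pos1 lam by (simp add: numeral_2_eq_2)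
  qed
  show thesis
  proof (rule that[OF a(1) b(1) c(1) u p_pos])
    fix v k assume v: "v \<in> V \<union> {a, b, c}"
    then have vL: "v \<in> L" using V a b c by auto
    have wd: "width v < p - 1" using M[OF v] by (simp add: p_def)
    show "qm (pos 2) (v [^] (k::nat)) = 0"
    proof (cases "v = a")
      case False
      then have nc: "\<not> commens a v" using v a b c by auto
      show ?thesis
        using cross_pow_empty[OF vL a(1) one_closed nc mid_a wd u] by (rule qm_pow_eq_0)
    next
      case True
      then have nc: "\<not> commens b v" using b by auto
      have ap: "a [^] p \<in> carrier G" using cl by simp
      show ?thesis
        using cross_pow_empty[OF vL b(1) ap nc mid_b wd u] by (rule qm_pow_eq_0)
    qed
  next
    fix k :: nat
    have wu: "?w = pos 2 \<otimes> c [^] p" using pos2 by simp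
    have "?w [^] k \<in> carrier G" using w by simp
    then obtain T where T: "finite T" "linked T" "{\<one>, ?w [^] k} \<subseteq> T"
      using linked_finite_superset[OF linked_carrier, of "{\<one>, ?w [^] k}"] by auto
    have "finite (cross (pos 2) \<one> (?w [^] k))" using cross_finite(1)[OF u T(2,1)] T(3) by blast
    then have "k - 1 \<le> card (cross (pos 2) \<one> (?w [^] k))"
      using cross_pow_card[OF u L_pow[OF c(1) p_pos], of k] wu by simp
    then have "real k - 1 \<le> real (card (cross (pos 2) \<one> (?w [^] k)))" by linarith
    moreover have "cross (pos 2) (?w [^] k) \<one> = {}" using no_reversed_crossing[of "3 * k"] pos3 by simp
    ultimately show "real k - 1 \<le> qm (pos 2) (?w [^] k)" by (simp add: qm_def net_def)
  qed
qed

end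

section \<open>From quasimorphisms to a basis of size continuum\<close>

text \<open>Vandermonde in polynomial form: the relation extends to all polynomials, and one that
  vanishes on \<open>T\<close> except at \<open>t\<close> isolates \<open>u t\<close>.\<close>

lemma power_functions_independent:
  fixes u :: "'a::field \<Rightarrow> 'a"
  assumes T: "finite T" and zero: "\<And>n. (\<Sum>t\<in>T. u t * t ^ n) = 0" and t: "t \<in> T"
  shows "u t = 0"
proof -
  have poly0: "(\<Sum>x\<in>T. u x * poly q x) = 0" for q
  proof -
    have "(\<Sum>x\<in>T. u x * poly q x) = (\<Sum>x\<in>T. \<Sum>i\<le>degree q. coeff q i * (u x * x ^ i))"
      by (simp add: poly_altdef sum_distrib_left mult.left_commute)
    also have "\<dots> = (\<Sum>i\<le>degree q. coeff q i * (\<Sum>x\<in>T. u x * x ^ i))"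
      by (subst sum.swap) (simp add: sum_distrib_left)
    finally show ?thesis by (simp add: zero)
  qed
  let ?q = "\<Prod>x\<in>T - {t}. [:- x, 1:]"
  have "poly ?q x = 0" if "x \<in> T - {t}" for x
    using that T by (auto simp: poly_prod intro: prod_zero)
  then have "(\<Sum>x\<in>T. u x * poly ?q x) = u t * poly ?q t"
    using T t by (simp add: sum.remove)
  moreover have "poly ?q t \<noteq> 0" using T by (auto simp: poly_prod)
  ultimately show ?thesis using poly0[of ?q] by simp
qed

context cayley_graph
begin

lemma countable_carrier: "countable (carrier G)"
proof -
  let ?R = "{(u, v). u \<in> carrier G \<and> v \<in> carrier G \<and> adj u v}"
  have "countable (?R `` Y)" if "countable Y" for Y
  proof -
    have "?R `` Y \<subseteq> (\<Union>y\<in>Y. (\<lambda>s. y \<otimes> s) ` S \<union> (\<lambda>s. y \<otimes> inv s) ` S)"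
    proof
      fix v assume "v \<in> ?R `` Y"
      then obtain y where y: "y \<in> Y" "y \<in> carrier G" "v \<in> carrier G" "adj y v" by blast
      then obtain s where s: "s \<in> S" "v = y \<otimes> s \<or> y = v \<otimes> s" by (auto simp: cayley_adj_def)
      then have "v = y \<otimes> s \<or> v = y \<otimes> inv s" using y S_subset by (auto simp: m_assoc subset_iff)
      then show "v \<in> (\<Union>y\<in>Y. (\<lambda>s. y \<otimes> s) ` S \<union> (\<lambda>s. y \<otimes> inv s) ` S)" using y s by blast
    qed
    moreover have "countable (\<Union>y\<in>Y. (\<lambda>s. y \<otimes> s) ` S \<union> (\<lambda>s. y \<otimes> inv s) ` S)"
      using that finite_S by (simp add: countable_finite)
    ultimately show ?thesis by (rule countable_subset)
  qed
  then have "countable (?R\<^sup>* `` {\<one>})" by (rule countable_rtrancl) auto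
  moreover have "carrier G \<subseteq> ?R\<^sup>* `` {\<one>}"
    using linked_carrier by (auto simp: linked_def conn_def)
  ultimately show ?thesis by (rule countable_subset[rotated])
qed

end

context ping_pong
begin

text \<open>As words, neither is a prefix of the other: for \<open>k < l\<close>, after the common
  part \<open>a [^] Suc k\<close> one continues with \<open>b\<close> and the other with
  \<open>a\<close>.\<close>

lemma powers_disjoint:
  assumes a: "a \<in> L" and b: "b \<in> L" and ab: "(a <# P) \<inter> (b <# P) = {}" and "k \<noteq> l"
  shows "(a [^] Suc k \<otimes> b <# P) \<inter> (a [^] Suc l \<otimes> b <# P) = {}"
  using assms(4)
proof (induction k l rule: linorder_wlog)
  case (le k l)
  have c: "a \<in> carrier G" "b \<in> carrier G" using a b L_closed by auto
  let ?x = "a [^] (l - Suc k) \<otimes> b"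
  have x: "?x \<in> L" using L_mult[OF L_pow[OF a] b] b c by (cases "l - Suc k = 0") auto
  have "a [^] Suc l = a [^] Suc k \<otimes> (a \<otimes> a [^] (l - Suc k))"
  proof -
    have "Suc l = Suc k + Suc (l - Suc k)" using le by simp
    then have "a [^] Suc l = a [^] Suc k \<otimes> a [^] Suc (l - Suc k)"
      using c by (simp only: nat_pow_mult)
    then show ?thesis using c by (simp only: nat_pow_Suc2)
  qed
  then have "a [^] Suc l \<otimes> b = a [^] Suc k \<otimes> (a \<otimes> ?x)"
    using c by (simp add: m_assoc del: nat_pow_Suc)
  then have "a [^] Suc l \<otimes> b <# P = a [^] Suc k <# (a <# (?x <# P))"
    using c P_closed l_coset_closed by (simp add: l_coset_mult del: nat_pow_Suc)
  also have "\<dots> \<subseteq> a [^] Suc k <# (a <# P)" by (intro l_coset_mono L_P x)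
  finally have 1: "a [^] Suc l \<otimes> b <# P \<subseteq> a [^] Suc k <# (a <# P)" .
  have 2: "a [^] Suc k \<otimes> b <# P = a [^] Suc k <# (b <# P)"
    using c P_closed by (simp add: l_coset_mult del: nat_pow_Suc)
  have "(a [^] Suc k <# (a <# P)) \<inter> (a [^] Suc k <# (b <# P)) = a [^] Suc k <# ((a <# P) \<inter> (b <# P))"
    using c P_closed l_coset_closed by (intro l_coset_Int[symmetric]) (auto simp del: nat_pow_Suc)
  also have "\<dots> = {}" by (simp only: ab l_coset_empty_iff)
  finally have "(a [^] Suc k <# (a <# P)) \<inter> (a [^] Suc k <# (b <# P)) = {}" .
  then show ?case using 1 2 by blast
qed (simp add: Int_commute)

end

text \<open>The interface to the linear algebra. The growth of \<open>f m\<close> on the powers of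
  the \<open>n\<close>-th word is triangular in \<open>m\<close> and \<open>n\<close>; the vanishing
  on powers of the letters will exclude homomorphisms.\<close>

locale detecting = group G for G (structure) +
  fixes f :: "nat \<Rightarrow> 'a \<Rightarrow> real" and D :: "nat \<Rightarrow> real" and a b c :: "nat \<Rightarrow> 'a" and p :: "nat \<Rightarrow> nat"
  assumes D_ge_one: "1 \<le> D n"
    and f_defect: "g \<in> carrier G \<Longrightarrow> h \<in> carrier G \<Longrightarrow> \<bar>f n h - f n (g \<otimes> h) + f n g\<bar> \<le> D n"
    and f_bounded: "g \<in> carrier G \<Longrightarrow> \<exists>C. \<forall>n. \<bar>f n g\<bar> \<le> C"
    and abc_closed: "a n \<in> carrier G" "b n \<in> carrier G" "c n \<in> carrier G"
    and f_abc: "n \<le> m \<Longrightarrow> v \<in> {a n, b n, c n} \<Longrightarrow> f m (v [^] (k::nat)) = 0"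
    and f_later: "n < m \<Longrightarrow> f m ((a n [^] p n \<otimes> b n [^] p n \<otimes> c n [^] p n) [^] (k::nat)) = 0"
    and f_grows: "real k - 1 \<le> f n ((a n [^] p n \<otimes> b n [^] p n \<otimes> c n [^] p n) [^] k)"
    and countable_G: "countable (carrier G)"

context ping_pong
begin

text \<open>Dependent choice: each stage carries the finite set of all earlier letters and words,
  and \<open>ex_detecting_qm\<close> supplies new letters and a function that vanishes on the powers
  of these.\<close>

lemma ex_detecting_family:
  fixes A :: "nat \<Rightarrow> 'a"
  assumes A: "\<And>k. A k \<in> L" "\<And>k l. k \<noteq> l \<Longrightarrow> (A k <# P) \<inter> (A l <# P) = {}"
  shows "\<exists>f D a b c p. detecting G f D a b c p"
proof -
  define good where "good = (\<lambda>V (a, b, c, u, p).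
    a \<in> L \<and> b \<in> L \<and> c \<in> L \<and> u \<in> L \<and> 0 < p \<and>
    (\<forall>v\<in>V \<union> {a, b, c}. \<forall>k. qm u (v [^] (k::nat)) = 0) \<and>
    (\<forall>k. real k - 1 \<le> qm u ((a [^] (p::nat) \<otimes> b [^] p \<otimes> c [^] p) [^] k)))"
  define ext where "ext = (\<lambda>(a, b, c, u :: 'a, p::nat). {a, b, c, a [^] p \<otimes> b [^] p \<otimes> c [^] p})"
  have ex: "\<exists>t. good V t" if "finite V" "V \<subseteq> L" for V
  proof (rule ex_detecting_qm[of A V, OF A that])
    fix a b c u p
    assume "a \<in> L" "b \<in> L" "c \<in> L" "u \<in> L" "0 < p"
      "\<And>v k. v \<in> V \<union> {a, b, c} \<Longrightarrow> qm u (v [^] (k::nat)) = 0"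
      "\<And>k. real k - 1 \<le> qm u ((a [^] (p::nat) \<otimes> b [^] p \<otimes> c [^] p) [^] k)"
    then have "good V (a, b, c, u, p)" unfolding good_def by simp
    then show "\<exists>t. good V t" ..
  qed
  have ext: "finite (ext t)" "ext t \<subseteq> L" if "good V t" for V t
    using that by (cases t; simp add: good_def ext_def L_mult L_pow)+
  let ?P = "\<lambda>n s. finite (fst s) \<and> fst s \<subseteq> L \<and> good (fst s) (snd s)"
  let ?Q = "\<lambda>(n::nat) s s'. fst s' = fst s \<union> ext (snd s)"
  have "\<exists>s. \<forall>n. ?P n (s n) \<and> ?Q n (s n) (s (Suc n))"
  proof (rule dependent_nat_choice)
    obtain t where "good {} t" using ex[of "{}"] by blast
    then show "\<exists>s. ?P 0 s" by (intro exI[of _ "({}, t)"]) simp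
    fix s n assume s: "?P n s"
    then have "finite (fst s \<union> ext (snd s))" "fst s \<union> ext (snd s) \<subseteq> L"
      using s ext[of "fst s" "snd s"] by simp_all
    from ex[OF this] obtain t where "good (fst s \<union> ext (snd s)) t" ..
    then show "\<exists>s'. ?P (Suc n) s' \<and> ?Q n s s'"
      using \<open>finite (fst s \<union> ext (snd s))\<close> \<open>fst s \<union> ext (snd s) \<subseteq> L\<close>
      by (intro exI[of _ "(fst s \<union> ext (snd s), t)"]) simp
  qed
  then obtain s where s: "\<And>n. ?P n (s n)" "\<And>n. ?Q n (s n) (s (Suc n))" by blast
  define V where "V = (\<lambda>n. fst (s n))"
  define a where "a = (\<lambda>n. fst (snd (s n)))"
  define b where "b = (\<lambda>n. fst (snd (snd (s n))))"
  define c where "c = (\<lambda>n. fst (snd (snd (snd (s n)))))"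
  define u where "u = (\<lambda>n. fst (snd (snd (snd (snd (s n))))))"
  define p where "p = (\<lambda>n. snd (snd (snd (snd (snd (s n))))))"
  let ?w = "\<lambda>n. a n [^] p n \<otimes> b n [^] p n \<otimes> c n [^] p n"
  have g: "good (V n) (a n, b n, c n, u n, p n)" for n
    using s(1)[of n] by (simp add: V_def a_def b_def c_def u_def p_def)
  then have L: "a n \<in> L" "b n \<in> L" "c n \<in> L" "u n \<in> L" for n
    by (simp_all add: good_def)
  have zero: "qm (u n) (v [^] (k::nat)) = 0" if "v \<in> V n \<union> {a n, b n, c n}" for n v k
    using g[of n] that unfolding good_def by blast
  have V_Suc: "V (Suc n) = V n \<union> {a n, b n, c n, ?w n}" for n
    using s(2)[of n] unfolding V_def a_def b_def c_def p_def ext_def by (simp split: prod.splits)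
  have V_mono: "V n \<subseteq> V m" if "n \<le> m" for n m
    using that by (rule lift_Suc_mono_le[rotated]) (use V_Suc in auto)
  have V_less: "{a n, b n, c n, ?w n} \<subseteq> V m" if "n < m" for n m
    using V_mono[of "Suc n" m] V_Suc[of n] that by auto
  have "detecting G (\<lambda>n. qm (u n)) (\<lambda>n. defect (u n)) a b c p"
  proof
    fix n :: nat
    show "1 \<le> defect (u n)" by (rule defect_ge_one[OF L(4)])
    show "a n \<in> carrier G" "b n \<in> carrier G" "c n \<in> carrier G" using L L_closed by auto
    show "\<bar>qm (u n) h - qm (u n) (g \<otimes> h) + qm (u n) g\<bar> \<le> defect (u n)"
      if "g \<in> carrier G" "h \<in> carrier G" for g h
      by (rule qm_defect[OF L(4) that])
    show "\<exists>C. \<forall>n. \<bar>qm (u n) g\<bar> \<le> C" if g: "g \<in> carrier G" for g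
    proof -
      obtain C where "\<And>x. x \<in> L \<Longrightarrow> \<bar>qm x g\<bar> \<le> C" using qm_bounded[OF g] by blast
      then show ?thesis using L(4) by blast
    qed
    show "qm (u m) (v [^] (k::nat)) = 0" if "n \<le> m" "v \<in> {a n, b n, c n}" for m v k
    proof (cases "n = m")
      case False
      then have "v \<in> V m" using V_less[of n m] that by auto
      then show ?thesis using zero by blast
    qed (use zero that in blast)
    show "qm (u m) (?w n [^] (k::nat)) = 0" if "n < m" for m k
      using zero[of "?w n" m k] V_less[OF that] by blast
    show "real k - 1 \<le> qm (u n) (?w n [^] k)" for k
      using g[of n] unfolding good_def by blast
    show "countable (carrier G)" by (rule countable_carrier)
  qed
  then show ?thesis by blast
qed

end

context cayley_graph
begin

text \<open>Three infinite components for \<open>K0\<close> are enough. After \<open>K0\<close> is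
  enlarged to a connected \<open>K\<close>, each of them still contains a translate of
  \<open>K\<close> disjoint from \<open>K\<close>, as only finitely many translates meet
  \<open>K\<close>.\<close>

lemma ex_detecting:
  assumes "infinitely_many_ends G S"
  shows "\<exists>f D a b c p. detecting G f D a b c p"
proof -
  obtain K0 \<C> where K0: "finite K0" "K0 \<subseteq> carrier G"
    and \<C>: "\<C> \<subseteq> infinite_components G S K0" "card \<C> = 3"
    using assms[unfolded infinitely_many_ends_def, THEN spec, of 3] by (elim exE conjE bexE) (rule that)
  obtain K where K: "K \<subseteq> carrier G" "finite K" "linked K" "insert \<one> K0 \<subseteq> K"
    using linked_finite_superset[OF linked_carrier, of "insert \<one> K0"] K0 by auto
  interpret cut G S K using K by unfold_locales auto
  have deep: "\<exists>x E. x \<in> carrier G \<and> comp K E \<and> x <# K \<subseteq> E \<and> E \<subseteq> C \<and> comp K0 C"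
    if "C \<in> \<C>" for C
  proof -
    have "C \<in> infinite_components G S K0" using that \<C> by blast
    then have C: "comp K0 C" "infinite C"
      unfolding infinite_components_def using comp_cayley_component by auto
    have "infinite (C - {g \<in> carrier G. (g <# K) \<inter> K \<noteq> {}})"
      using C(2) finite_meeting(1)[OF K(2) K(2) K(1) K(1)] by (rule Diff_infinite_finite[rotated])
    from infinite_imp_nonempty[OF this]
    obtain x where x: "x \<in> C" "x \<notin> {g \<in> carrier G. (g <# K) \<inter> K \<noteq> {}}" by blast
    have xc: "x \<in> carrier G" using x(1) comp_closed[OF C(1)] by blast
    then have dis: "(x <# K) \<inter> K = {}" using x(2) by simp
    have xx: "x \<in> x <# K" using l_coset_mem[OF one_K, of x] xc by simp
    then obtain E where E: "comp K E" "x \<in> E" using comp_exists[OF xc] dis by blast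
    have "x <# K \<subseteq> E" using comp_max[OF E(1) linked_translate[OF K(3) xc] dis] xx E(2) by blast
    moreover have "E \<subseteq> C"
      using comp_max[OF C(1) comp_linked[OF E(1)]] comp_disjoint[OF E(1)] K(4) x(1) E(2) by blast
    ultimately show ?thesis using xc E(1) C(1) by blast
  qed
  obtain C1 C2 C3 where C: "C1 \<in> \<C>" "C2 \<in> \<C>" "C3 \<in> \<C>" "C1 \<noteq> C2" "C2 \<noteq> C3" "C1 \<noteq> C3"
    using \<C>(2) unfolding card_3_iff by blast
  obtain x1 E1 where 1: "x1 \<in> carrier G" "comp K E1" "x1 <# K \<subseteq> E1" "E1 \<subseteq> C1" "comp K0 C1"
    using deep[OF C(1)] by blast
  obtain x2 E2 where 2: "x2 \<in> carrier G" "comp K E2" "x2 <# K \<subseteq> E2" "E2 \<subseteq> C2" "comp K0 C2"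
    using deep[OF C(2)] by blast
  obtain x3 E3 where 3: "x3 \<in> carrier G" "comp K E3" "x3 <# K \<subseteq> E3" "E3 \<subseteq> C3" "comp K0 C3"
    using deep[OF C(3)] by blast
  have distinct: "E \<noteq> E'"
    if "comp K E" "E \<subseteq> C" "comp K0 C" "E' \<subseteq> C'" "comp K0 C'" "C \<noteq> C'" for E E' C C'
    using comp_eq[OF that(3,5)] that(2,4,6) comp_nonempty[OF that(1)] by auto
  have ne: "E1 \<noteq> E2" "E2 \<noteq> E3" "E1 \<noteq> E3"
    using distinct[OF 1(2,4,5) 2(4,5)] distinct[OF 2(2,4,5) 3(4,5)] distinct[OF 1(2,4,5) 3(4,5)] C(4-6)
    by simp_all
  \<comment> \<open>Two components give a translating element; one of the three differs from both
    \<open>I\<close> and \<open>J\<close> and provides the branching.\<close>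
  obtain s I J where s: "moves s I J" "I \<noteq> J"
    using moves_exists_distinct[OF ne(1) 1(1-3) 2(1-3)] by blast
  obtain x E where E: "x \<in> carrier G" "comp K E" "x <# K \<subseteq> E" "E \<noteq> I" "E \<noteq> J"
  proof -
    consider "E1 \<notin> {I, J}" | "E2 \<notin> {I, J}" | "E3 \<notin> {I, J}" using ne by blast
    then show thesis by cases (use 1 2 3 that in auto)
  qed
  obtain F where "moves x E F" using moves_exists[OF E(1-3)] by blast
  from ping_pong_pair[OF s this E(4,5)] obtain P Q a b
    where ab: "P \<noteq> Q" "moves a P Q" "moves b P Q" "(a <# P) \<inter> (b <# P) = {}" by blast
  interpret ping_pong G S K P Q using ab by unfold_locales (auto simp: moves_def)
  have L: "a \<in> L" "b \<in> L" using ab by (simp_all add: L_def)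
  show ?thesis
  proof (rule ex_detecting_family[of "\<lambda>k. a [^] Suc k \<otimes> b"])
    show "a [^] Suc k \<otimes> b \<in> L" for k by (rule L_mult[OF L_pow[OF L(1)] L(2)]) simp
    show "(a [^] Suc k \<otimes> b <# P) \<inter> (a [^] Suc l \<otimes> b <# P) = {}" if "k \<noteq> l" for k l
      by (rule powers_disjoint[OF L ab(4) that])
  qed
qed

end

section \<open>Bases of bounded cohomology and their cardinality\<close>

context group
begin

lemma bounded_2coboundary_zero: "(\<And>g h. g \<in> carrier G \<Longrightarrow> h \<in> carrier G \<Longrightarrow> e g h = 0) \<Longrightarrow> bounded_2coboundary G e"
  unfolding bounded_2coboundary_def bounded1_def by (intro exI[of _ "\<lambda>_. 0"]) auto

lemma bounded_2coboundary_scale: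
  assumes "bounded_2coboundary G e" "\<And>g h. g \<in> carrier G \<Longrightarrow> h \<in> carrier G \<Longrightarrow> e' g h = r * e g h"
  shows "bounded_2coboundary G e'"
proof -
  obtain \<phi> M where \<phi>: "\<forall>g\<in>carrier G. \<bar>\<phi> g\<bar> \<le> M"
    "\<forall>g\<in>carrier G. \<forall>h\<in>carrier G. e g h = \<phi> h - \<phi> (g \<otimes> h) + \<phi> g"
    using assms(1) unfolding bounded_2coboundary_def bounded1_def by blast
  have "\<bar>r * \<phi> g\<bar> \<le> \<bar>r\<bar> * M" if "g \<in> carrier G" for g
    using \<phi>(1) that by (simp add: abs_mult mult_left_mono)
  moreover have "e' g h = r * \<phi> h - r * \<phi> (g \<otimes> h) + r * \<phi> g" if "g \<in> carrier G" "h \<in> carrier G" for g h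
    using assms(2)[OF that] \<phi>(2) that by (simp add: algebra_simps)
  ultimately show ?thesis
    unfolding bounded_2coboundary_def bounded1_def by (intro exI[of _ "\<lambda>g. r * \<phi> g"]) auto
qed

text \<open>The first two clauses of \<open>H2b_basis\<close>: independence of the classes, not
  merely of the functions.\<close>

definition independent2 :: "('a \<Rightarrow> 'a \<Rightarrow> real) set \<Rightarrow> bool" where
  "independent2 B \<longleftrightarrow> (\<forall>c\<in>B. bounded_2cocycle G c) \<and>
     (\<forall>F u. finite F \<longrightarrow> F \<subseteq> B \<longrightarrow> bounded_2coboundary G (lincomb2 u id F) \<longrightarrow> (\<forall>c\<in>F. u c = 0))"

lemma independent2D:
  "independent2 B \<Longrightarrow> finite F \<Longrightarrow> F \<subseteq> B \<Longrightarrow> bounded_2coboundary G (lincomb2 u id F) \<Longrightarrow> c \<in> F \<Longrightarrow> u c = 0"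
  unfolding independent2_def by blast

text \<open>Zorn's lemma: a relation involves finitely many cocycles, hence lies in one member of a
  chain, and a maximal independent set spans.\<close>

lemma ex_basis_extending:
  assumes "independent2 B0"
  obtains B where "B0 \<subseteq> B" "independent2 B" "H2b_basis G B"
proof -
  let ?A = "{B. B0 \<subseteq> B \<and> independent2 B}"
  have "\<exists>M\<in>?A. \<forall>X\<in>?A. M \<subseteq> X \<longrightarrow> X = M"
  proof (rule subset_Zorn)
    fix C assume C: "subset.chain ?A C"
    then have CA: "C \<subseteq> ?A" by (auto simp: subset.chain_def)
    show "\<exists>U\<in>?A. \<forall>X\<in>C. X \<subseteq> U"
    proof (cases "C = {}")
      case False
      have "independent2 (\<Union>C)"
        unfolding independent2_def
      proof (intro conjI allI impI)
        show "\<forall>c\<in>\<Union>C. bounded_2cocycle G c" using CA by (auto simp: independent2_def)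
        fix F u assume F: "finite F" "F \<subseteq> \<Union>C" "bounded_2coboundary G (lincomb2 u id F)"
        obtain X where "X \<in> C" "F \<subseteq> X"
          using finite_subset_Union_chain[OF F(1,2) False C] by blast
        moreover have "independent2 X" using CA \<open>X \<in> C\<close> by blast
        ultimately show "\<forall>c\<in>F. u c = 0" using independent2D[OF _ F(1) _ F(3)] by blast
      qed
      moreover have "B0 \<subseteq> \<Union>C" using False CA by blast
      ultimately show ?thesis by (intro bexI[of _ "\<Union>C"]) auto
    qed (use assms in auto)
  qed
  then obtain B where BA: "B \<in> ?A" and Bmax: "\<forall>X\<in>?A. B \<subseteq> X \<longrightarrow> X = B" by (rule bexE)
  then have B: "B0 \<subseteq> B" "independent2 B" by simp_all
  have max: "X = B" if "B0 \<subseteq> X" "independent2 X" "B \<subseteq> X" for X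
    using bspec[OF Bmax, of X] that by simp
  have span: "\<exists>F u. finite F \<and> F \<subseteq> B \<and> bounded_2coboundary G (\<lambda>g h. e g h - lincomb2 u id F g h)"
    if e: "bounded_2cocycle G e" for e
  proof (cases "e \<in> B")
    case True
    then show ?thesis
      by (intro exI[of _ "{e}"] exI[of _ "\<lambda>_. 1"] conjI bounded_2coboundary_zero)
        (auto simp: lincomb2_def)
  next
    case False
    have "\<not> independent2 (insert e B)"
    proof
      assume "independent2 (insert e B)"
      then have "insert e B = B" using max[of "insert e B"] B(1) by blast
      then show False using False by blast
    qed
    then obtain F u d where F: "finite F" "F \<subseteq> insert e B" "bounded_2coboundary G (lincomb2 u id F)"
      and d: "d \<in> F" "u d \<noteq> 0"
      using B(2) e unfolding independent2_def by blast
    have FB: "finite (F - {e})" "F - {e} \<subseteq> B" using F by auto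
    have eF: "e \<in> F"
    proof (rule ccontr)
      assume "e \<notin> F"
      then have "F \<subseteq> B" using F(2) by blast
      from independent2D[OF B(2) F(1) this F(3) d(1)] show False using d(2) by simp
    qed
    then have split: "lincomb2 u id F g h = u e * e g h + lincomb2 u id (F - {e}) g h" for g h
      using F(1) by (simp add: lincomb2_def sum.remove)
    \<comment> \<open>Otherwise the relation would live inside \<open>B\<close>.\<close>
    have "u e \<noteq> 0"
    proof
      assume ue: "u e = 0"
      then have "lincomb2 u id F = lincomb2 u id (F - {e})" using split by (intro ext) simp
      then have "bounded_2coboundary G (lincomb2 u id (F - {e}))" using F(3) by simp
      from independent2D[OF B(2) FB this, of d] show False using d ue by (cases "d = e") auto
    qed
    have "bounded_2coboundary G (\<lambda>g h. e g h - lincomb2 (\<lambda>x. - u x / u e) id (F - {e}) g h)"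
    proof (rule bounded_2coboundary_scale[OF F(3), where r = "1 / u e"])
      fix g h
      have "lincomb2 (\<lambda>x. - u x / u e) id (F - {e}) g h = - (lincomb2 u id (F - {e}) g h / u e)"
        by (simp add: lincomb2_def sum_divide_distrib flip: sum_negf)
      then show "e g h - lincomb2 (\<lambda>x. - u x / u e) id (F - {e}) g h = 1 / u e * lincomb2 u id F g h"
        using \<open>u e \<noteq> 0\<close> by (simp add: split field_simps)
    qed
    then show ?thesis using FB by blast
  qed
  have "H2b_basis G B" using B(2) span unfolding H2b_basis_def independent2_def by blast
  then show thesis using that B by blast
qed

text \<open>A cocycle is coded by its values on the countable carrier as a set of naturals.\<close>

lemma independent2_lepoll_real:
  assumes B: "independent2 B" and "countable (carrier G)"
  shows "B \<lesssim> (UNIV :: real set)"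
proof -
  obtain r :: "real \<Rightarrow> nat set" where r: "inj r"
    using nat_sets_eqpoll_reals eqpoll_imp_lepoll eqpoll_sym unfolding lepoll_def by blast
  let ?e = "from_nat_into (carrier G)"
  define code where "code = (\<lambda>(c::'a \<Rightarrow> 'a \<Rightarrow> real).
    {prod_encode (n, prod_encode (m, j)) | n m j. j \<in> r (c (?e n) (?e m))})"
  have "inj_on code B"
  proof (rule inj_onI)
    fix c d assume cd: "c \<in> B" "d \<in> B" "code c = code d"
    have enc: "r (x (?e n) (?e m)) = {j. prod_encode (n, prod_encode (m, j)) \<in> code x}" for x n m
      by (auto simp: code_def)
    have eq: "c g h = d g h" if gh: "g \<in> carrier G" "h \<in> carrier G" for g h
    proof -
      obtain n m where nm: "?e n = g" "?e m = h"
        using from_nat_into_surj[OF assms(2)] gh by metis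
      have "r (c (?e n) (?e m)) = r (d (?e n) (?e m))" by (simp only: enc cd(3))
      then show ?thesis using injD[OF r] nm by blast
    qed
    \<comment> \<open>The code does not see values off the carrier. If the functions differed only
      there, their difference would be a coboundary, against independence.\<close>
    show "c = d"
    proof (rule ccontr)
      assume "c \<noteq> d"
      then have "bounded_2coboundary G (lincomb2 (\<lambda>x. if x = c then 1 else -1) id {c, d})"
        using eq by (intro bounded_2coboundary_zero) (auto simp: lincomb2_def)
      moreover have "finite {c, d}" "{c, d} \<subseteq> B" using cd by auto
      ultimately have "(if c = c then 1 else -1 :: real) = 0"
        using independent2D[OF B, of "{c, d}" "\<lambda>x. if x = c then 1 else -1" c] by simp
      then show False by simp
    qed
  qed
  then have "B \<lesssim> (UNIV :: nat set set)" unfolding lepoll_def by blast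
  then show ?thesis
    using nat_sets_eqpoll_reals eqpoll_imp_lepoll lepoll_trans by blast
qed

end

section \<open>A continuum of independent classes\<close>

context detecting
begin

text \<open>Dividing by \<open>D n\<close> gives each summand defect at most \<open>t ^ n\<close>,
  so for \<open>0 < t < 1\<close> the coboundary is bounded although \<open>Phi t\<close> need not
  be.\<close>

definition Phi :: "real \<Rightarrow> 'a \<Rightarrow> real" where
  "Phi t g = (\<Sum>n. t ^ n * (f n g / D n))"

definition coc :: "real \<Rightarrow> 'a \<Rightarrow> 'a \<Rightarrow> real" where
  "coc t g h = Phi t h - Phi t (g \<otimes> h) + Phi t g"

lemma D_pos: "0 < D n"
  using D_ge_one[of n] by linarith

lemma summable_Phi:
  assumes "t \<in> {0<..<1}" "g \<in> carrier G"
  shows "summable (\<lambda>n. t ^ n * (f n g / D n))"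
proof -
  obtain C where C: "\<And>n. \<bar>f n g\<bar> \<le> C" using f_bounded[OF assms(2)] by blast
  show ?thesis
  proof (rule summable_comparison_test')
    show "summable (\<lambda>n. t ^ n * C)" using assms(1) by (intro summable_mult2 summable_geometric) simp
    fix n :: nat
    have "\<bar>f n g / D n\<bar> \<le> \<bar>f n g\<bar>"
      using D_ge_one[of n] D_pos[of n] by (simp add: divide_le_eq mult_left_le[of _ 1] mult_le_cancel_left1)
    then have "\<bar>f n g / D n\<bar> \<le> C" using C[of n] by linarith
    then have "t ^ n * \<bar>f n g / D n\<bar> \<le> t ^ n * C"
      using assms(1) by (intro mult_left_mono) auto
    then show "norm (t ^ n * (f n g / D n)) \<le> t ^ n * C"
      using assms(1) by (simp add: abs_mult)
  qed
qed

lemma coc_cocycle: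
  assumes t: "t \<in> {0<..<1}"
  shows "bounded_2cocycle G (coc t)"
  unfolding bounded_2cocycle_def
proof (intro conjI ballI)
  have geo: "summable (\<lambda>n. t ^ n)" using t by (intro summable_geometric) simp
  have "\<bar>coc t g h\<bar> \<le> (\<Sum>n. t ^ n)" if gh: "g \<in> carrier G" "h \<in> carrier G" for g h
  proof -
    let ?F = "\<lambda>x n. t ^ n * (f n x / D n)"
    note sm = summable_sums[OF summable_Phi[OF t]]
    have "(\<lambda>n. ?F h n - ?F (g \<otimes> h) n + ?F g n) sums coc t g h"
      unfolding coc_def Phi_def using gh by (intro sums_add sums_diff sm) auto
    moreover have "?F h n - ?F (g \<otimes> h) n + ?F g n = t ^ n * ((f n h - f n (g \<otimes> h) + f n g) / D n)" for n
      by (simp add: algebra_simps diff_divide_distrib add_divide_distrib)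
    ultimately have "coc t g h = (\<Sum>n. t ^ n * ((f n h - f n (g \<otimes> h) + f n g) / D n))"
      by (simp add: sums_iff)
    moreover have "norm (\<Sum>n. t ^ n * ((f n h - f n (g \<otimes> h) + f n g) / D n)) \<le> (\<Sum>n. t ^ n)"
    proof (rule norm_suminf_le[OF _ geo])
      fix n
      have "\<bar>(f n h - f n (g \<otimes> h) + f n g) / D n\<bar> \<le> 1"
        using f_defect[OF gh, of n] D_pos[of n] by (simp add: divide_le_eq)
      then have "t ^ n * \<bar>(f n h - f n (g \<otimes> h) + f n g) / D n\<bar> \<le> t ^ n * 1"
        using t by (intro mult_left_mono) auto
      then show "norm (t ^ n * ((f n h - f n (g \<otimes> h) + f n g) / D n)) \<le> t ^ n"
        using t by (simp add: abs_mult)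
    qed
    ultimately show ?thesis by simp
  qed
  then show "bounded2 G (coc t)" unfolding bounded2_def by blast
qed (simp add: coc_def m_assoc)

text \<open>If the combination is the coboundary of a bounded \<open>\<beta>\<close>, then
  \<open>psi = Psi - \<beta>\<close> is a homomorphism. By induction on \<open>n\<close> it vanishes
  on the three letters, hence on the word; so \<open>Psi\<close> is bounded on powers of the word,
  where only the \<open>n\<close>-th term survives and \<open>f n\<close> grows. This forces
  \<open>s n = 0\<close> for all \<open>n\<close>.\<close>

lemma coc_independent:
  assumes T: "finite T" "T \<subseteq> {0<..<1}"
    and cob: "bounded_2coboundary G (\<lambda>g h. \<Sum>t\<in>T. u t * coc t g h)"
  shows "\<forall>t\<in>T. u t = 0"
proof -
  obtain \<beta> M where \<beta>: "\<And>g. g \<in> carrier G \<Longrightarrow> \<bar>\<beta> g\<bar> \<le> M"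
    and eq: "\<And>g h. g \<in> carrier G \<Longrightarrow> h \<in> carrier G \<Longrightarrow>
      (\<Sum>t\<in>T. u t * coc t g h) = \<beta> h - \<beta> (g \<otimes> h) + \<beta> g"
    using cob unfolding bounded_2coboundary_def bounded1_def by blast
  define s where "s = (\<lambda>n. \<Sum>t\<in>T. u t * t ^ n)"
  define Psi where "Psi = (\<lambda>g. \<Sum>t\<in>T. u t * Phi t g)"
  define psi where "psi = (\<lambda>g. Psi g - \<beta> g)"
  have Psi: "Psi g = (\<Sum>n. s n * (f n g / D n))" if g: "g \<in> carrier G" for g
  proof -
    have "Psi g = (\<Sum>t\<in>T. \<Sum>n. u t * (t ^ n * (f n g / D n)))"
      unfolding Psi_def Phi_def using T(2) g
      by (intro sum.cong suminf_mult[symmetric] summable_Phi) auto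
    also have "\<dots> = (\<Sum>n. \<Sum>t\<in>T. u t * (t ^ n * (f n g / D n)))"
      using T(2) g by (intro suminf_sum[symmetric] summable_mult summable_Phi) auto
    also have "\<dots> = (\<Sum>n. s n * (f n g / D n))"
      by (simp only: s_def sum_distrib_right mult.assoc)
    finally show ?thesis .
  qed
  have hom: "psi (g \<otimes> h) = psi g + psi h" if "g \<in> carrier G" "h \<in> carrier G" for g h
  proof -
    have "(\<Sum>t\<in>T. u t * coc t g h) = Psi h - Psi (g \<otimes> h) + Psi g"
      by (simp add: Psi_def coc_def algebra_simps sum.distrib sum_subtractf)
    then show ?thesis using eq[OF that] by (simp add: psi_def)
  qed
  have pow: "psi (g [^] (k::nat)) = real k * psi g" if "g \<in> carrier G" for g k
  proof (induction k)
    case 0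
    then show ?case using hom[of \<one> \<one>] by simp
  next
    case (Suc k)
    then show ?case using hom[of "g [^] k" g] that by (simp add: algebra_simps)
  qed
  have zero_if: "x = 0" if bd: "\<And>k::nat. \<bar>real k * x\<bar> \<le> C" for x C :: real
  proof (rule ccontr)
    assume "x \<noteq> 0"
    then obtain k :: nat where "C / \<bar>x\<bar> < real k" using reals_Archimedean2 by blast
    then show False using bd[of k] \<open>x \<noteq> 0\<close> by (simp add: abs_mult divide_less_eq)
  qed
  have s0: "s n = 0" for n
  proof (induction n rule: less_induct)
    case (less n)
    let ?w = "a n [^] p n \<otimes> b n [^] p n \<otimes> c n [^] p n"
    have wc: "?w \<in> carrier G" using abc_closed by simp
    have psi0: "psi v = 0" if v: "v \<in> {a n, b n, c n}" for v
    proof (rule zero_if)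
      fix k :: nat
      have vc: "v \<in> carrier G" using v abc_closed by auto
      \<comment> \<open>Terms below \<open>n\<close> vanish by induction, the others by
        \<open>f_abc\<close>.\<close>
      have z: "s m * (f m (v [^] k) / D m) = 0" for m
        using less f_abc[OF _ v, of m k] by (cases "m < n") auto
      have "Psi (v [^] k) = 0"
        using Psi[OF nat_pow_closed[OF vc, of k]] by (simp only: z suminf_zero)
      then have "real k * psi v = - \<beta> (v [^] k)" using pow[OF vc, of k] by (simp add: psi_def)
      then show "\<bar>real k * psi v\<bar> \<le> M" using \<beta>[of "v [^] k"] vc by simp
    qed
    have "psi ?w = 0"
      using abc_closed[of n] psi0 by (simp add: hom pow)
    have bd: "\<bar>s n * (f n (?w [^] k) / D n)\<bar> \<le> M" for k :: nat
    proof -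
      have z: "s m * (f m (?w [^] k) / D m) = 0" if "m \<notin> {n}" for m
        using less[of m] f_later[of n m k] that by (cases "m < n") auto
      have "Psi (?w [^] k) = (\<Sum>m\<in>{n}. s m * (f m (?w [^] k) / D m))"
        unfolding Psi[OF nat_pow_closed[OF wc, of k]] by (rule suminf_finite[OF _ z]) simp
      moreover have "psi (?w [^] k) = 0" using pow[OF wc, of k] \<open>psi ?w = 0\<close> by simp
      ultimately show ?thesis using \<beta>[of "?w [^] k"] wc by (simp add: psi_def)
    qed
    show "s n = 0"
    proof (rule zero_if)
      fix k :: nat
      \<comment> \<open>Passing to \<open>Suc k\<close> absorbs the \<open>- 1\<close> in
        \<open>f_grows\<close>.\<close>
      have "real k \<le> f n (?w [^] Suc k)" using f_grows[of "Suc k" n] by simp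
      then have "\<bar>s n\<bar> * real k \<le> \<bar>s n\<bar> * \<bar>f n (?w [^] Suc k)\<bar>" by (intro mult_left_mono) auto
      also have "\<dots> = \<bar>s n * (f n (?w [^] Suc k) / D n)\<bar> * D n"
        using D_pos[of n] by (simp add: abs_mult)
      also have "\<dots> \<le> M * D n" using bd[of "Suc k"] D_pos[of n] by (intro mult_right_mono) auto
      finally show "\<bar>real k * s n\<bar> \<le> M * D n" by (simp add: abs_mult mult.commute)
    qed
  qed
  show ?thesis
    using power_functions_independent[OF T(1), of u] s0 unfolding s_def by blast
qed

lemma dim_continuum: "H2b_dim_continuum G"
proof -
  let ?I = "{0<..<1::real}"
  have inj: "inj_on coc ?I"
  proof (rule inj_onI, rule ccontr)
    fix t t' assume t: "t \<in> ?I" "t' \<in> ?I" "coc t = coc t'" "t \<noteq> t'"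
    \<comment> \<open>Equal cocycles for two parameters would give a relation with coefficients 1
      and -1.\<close>
    have "\<forall>x\<in>{t, t'}. (if x = t then 1 else -1 :: real) = 0"
      using t by (intro coc_independent bounded_2coboundary_zero) auto
    then show False by simp
  qed
  have "independent2 (coc ` ?I)"
    unfolding independent2_def
  proof (intro conjI allI impI)
    show "\<forall>c\<in>coc ` ?I. bounded_2cocycle G c" using coc_cocycle by blast
    fix F u assume F: "finite F" "F \<subseteq> coc ` ?I" "bounded_2coboundary G (lincomb2 u id F)"
    then obtain T where T: "T \<subseteq> ?I" "finite T" "F = coc ` T" using finite_subset_image by metis
    have "lincomb2 u id F = (\<lambda>g h. \<Sum>t\<in>T. u (coc t) * coc t g h)"
      unfolding lincomb2_def T(3) by (subst sum.reindex[OF inj_on_subset[OF inj T(1)]]) simp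
    then have "\<forall>t\<in>T. u (coc t) = 0"
      using F(3) coc_independent[OF T(2,1), of "\<lambda>t. u (coc t)"] by simp
    then show "\<forall>c\<in>F. u c = 0" using T(3) by blast
  qed
  then obtain B where B: "coc ` ?I \<subseteq> B" "independent2 B" "H2b_basis G B"
    by (rule ex_basis_extending)
  \<comment> \<open>The parameters bound \<open>B\<close> from below and countability of the group
    bounds it from above; Schroeder-Bernstein concludes.\<close>
  have "(UNIV :: real set) \<lesssim> ?I"
    using open_interval_eqpoll_reals[of 0 1] by (simp add: eqpoll_sym eqpoll_imp_lepoll)
  also have "?I \<lesssim> B" unfolding lepoll_def using inj B(1) by blast
  finally have "B \<approx> (UNIV :: real set)"
    using independent2_lepoll_real[OF B(2) countable_G] by (intro lepoll_antisym)
  then show ?thesis using B(3) unfolding H2b_dim_continuum_def eqpoll_def by blast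
qed

end

theorem theorem3:
  fixes G :: "('a, 'b) monoid_scheme" and S :: "'a set"
  assumes "group G"
    and "finite S" and "S \<subseteq> carrier G" and "generate G S = carrier G"
    and "infinitely_many_ends G S"
  shows "H2b_dim_continuum G"
proof -
  interpret cayley_graph G S
    using assms by (simp add: cayley_graph_def cayley_graph_axioms_def)
  obtain f D a b c p where "detecting G f D a b c p" using ex_detecting[OF assms(5)] by blast
  then show ?thesis by (rule detecting.dim_continuum)
qed

end
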